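(* Let $A,\bar A\in\mathbb R^{n\times n}$, $B,\bar B\in\mathbb R^{n\times m}$ be constant matrices, and consider the stochastic system $$x(k+1)=[Ax(k)+Bu(k)]+w(k)[\bar A x(k)+\bar B u(k)],\qquad (\ast)$$ where $x(k)\in\mathbb R^n$, $u(k)\in\mathbb R^m$ and $k$ takes values in $[0,T]$, with $T$ finite or infinite. Assume $\operatorname{rank}(\bar B)=n$, let $M\in\mathbb R^{m\times m}$ be an invertible matrix with $\bar BM=[\,I_n\ \ 0\,]$, write $BM=[\,L\ \ F\,]$ with $L\in\mathbb R^{n\times n}$, $F\in\mathbb R^{n\times(m-n)}$, and assume that $A-L\bar A$ is invertible. Put $C=(A-L\bar A)^{-1}$, $\bar C=-(A-L\bar A)^{-1}L$, $D=-(A-L\bar A)^{-1}F$, $C(k)=C+\bar C w(k)$. Then the following are equivalent: 1. System $(\ast)$ is exactly controllable. 2. System $(\ast)$ is exactly null controllable. 3. There exists a positive integer $N$ such that the Gramian matrix $$G_N=\sum_{i=0}^N E\big[C(0)C(1)\cdots C(i-1)DD'C'(i-1)\cdots C'(0)\big]$$ is invertible (the product $C(0)\cdots C(i-1)$ is $I_n$ when $i=0$). 4. $\operatorname{rank}(R)=n$, where $R=[\,D\ \ CD\ \ \bar CD\ \ C^2D\ \ \bar C^2D\ \ C\bar CD\ \ \bar CCD\ \cdots]$ is the matrix whose blocks are all matrices $WD$, $W$ running over all finite products (including the empty product $I_n$) of the matrices $C$ and $\bar C$.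
   Context: Prime denotes transpose. The noise $w(k)$ is a sequence of i.i.d. one-dimensional random variables with zero mean and unit variance on a complete probability space $(\Omega,\mathcal F,\mathcal P)$; $\mathcal F(k)=\sigma\{w(0),\dots,w(k)\}$ and $\mathcal F(-1)$ is trivial. $[0,N]=\{0,1,\dots,N\}$. $L^2(\Omega,\mathbb R^s)$ is the space of square integrable $\mathbb R^s$-valued random vectors, and $l^2_{\mathcal F}([0,N],\mathbb R^s)$ is the space of square summable processes $m(k)\in L^2(\Omega,\mathbb R^s)$, $k\in[0,N]$, with $m(k)$ $\mathcal F(k-1)$-adapted for each $k$. Exactly null controllable: for any nonzero $x\in\mathbb R^n$, there exist a positive integer $N$ and a sequence of controllers $\{u(k),k\in[0,N]\}$ in $l^2_{\mathcal F}([0,N],\mathbb R^m)$ such that $x(0)=x$ and $x(N+1)=0$. Exactly controllable: for any nonzero $x\in\mathbb R^n$ and $\mathcal F(N)$-adapted $\xi\in\mathcal S$, there exist a positive integer $N$ and a sequence of controllers $\{u(k),k\in[0,N]\}$ in $l^2_{\mathcal F}([0,N],\mathbb R^m)$ such that $x(0)=x$ and $x(N+1)=\xi$. Here $\mathcal S$ is the set of $\xi\in L^2(\Omega,\mathbb R^n)$ such that the backward stochastic difference equation $$\tilde x(k)=C\tilde x(k+1)+\bar C\tilde z(k)-Cw(k)\tilde z(k),\qquad \tilde x(N+1)=\xi,$$ is solvable, i.e. has a solution $(\tilde x(k),\tilde z(k))$, $k\in[0,N]$, with $\tilde x(k),\tilde z(k)\in L^2(\Omega,\mathbb R^n)$ both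 $\mathcal F(k-1)$-adapted. *)

theory Defs
  imports
    "HOL-Probability.Probability"
    "Jordan_Normal_Form.Gauss_Jordan_Elimination"
    "Jordan_Normal_Form.DL_Rank"
begin

text \<open>
  Dimensions are natural numbers (\<open>carrier_vec\<close>, \<open>carrier_mat\<close>) rather than index types, because the
  blocks of width \<open>m - n\<close> may be empty.
\<close>

type_synonym rvec = "real Matrix.vec"
type_synonym rmat = "real Matrix.mat"

definition append_cols :: "rmat \<Rightarrow> rmat \<Rightarrow> rmat" where
  "append_cols X Y = four_block_mat X Y (0\<^sub>m 0 (dim_col X)) (0\<^sub>m 0 (dim_col Y))"


subsection \<open>Noise, adaptedness and square integrability\<close>

definition iid_noise :: "'a measure \<Rightarrow> (nat \<Rightarrow> 'a \<Rightarrow> real) \<Rightarrow> bool" where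
  "iid_noise P w \<longleftrightarrow>
     prob_space.indep_vars P (\<lambda>_. borel) w UNIV \<and>
     (\<forall>k. distr P borel (w k) = distr P borel (w 0)) \<and>
     (\<forall>k. integrable P (w k) \<and> integrable P (\<lambda>\<omega>. (w k \<omega>)\<^sup>2)) \<and>
     (\<forall>k. prob_space.expectation P (w k) = 0 \<and> prob_space.variance P (w k) = 1)"

text \<open>
  The index is shifted by one: \<open>past P w k\<close> is generated by \<open>w 0, \<dots>, w (k - 1)\<close>, so it is the
  \<open>\<sigma>\<close>-algebra \<open>F(k - 1)\<close>, with \<open>past P w 0\<close> the trivial one.
\<close>
definition past :: "'a measure \<Rightarrow> (nat \<Rightarrow> 'a \<Rightarrow> real) \<Rightarrow> nat \<Rightarrow> 'a measure" where
  "past P w k = sigma (space P) (\<Union>i<k. {w i -` S \<inter> space P | S. S \<in> sets borel})"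

definition vec_measurable :: "'a measure \<Rightarrow> nat \<Rightarrow> ('a \<Rightarrow> rvec) \<Rightarrow> bool" where
  "vec_measurable G s X \<longleftrightarrow>
     (\<forall>\<omega>\<in>space G. X \<omega> \<in> carrier_vec s) \<and>
     (\<forall>i<s. (\<lambda>\<omega>. vec_index (X \<omega>) i) \<in> borel_measurable G)"

definition L2 :: "'a measure \<Rightarrow> nat \<Rightarrow> ('a \<Rightarrow> rvec) set" where
  "L2 P s = {X. vec_measurable P s X \<and> integrable P (\<lambda>\<omega>. scalar_prod (X \<omega>) (X \<omega>))}"

definition l2F :: "'a measure \<Rightarrow> (nat \<Rightarrow> 'a \<Rightarrow> real) \<Rightarrow> nat \<Rightarrow> nat \<Rightarrow> (nat \<Rightarrow> 'a \<Rightarrow> rvec) set" where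
  "l2F P w N s = {v. \<forall>k\<le>N. v k \<in> L2 P s \<and> vec_measurable (past P w k) s (v k)}"


subsection \<open>The controlled system\<close>

primrec state ::
  "rmat \<Rightarrow> rmat \<Rightarrow> rmat \<Rightarrow> rmat \<Rightarrow> (nat \<Rightarrow> 'a \<Rightarrow> real) \<Rightarrow> (nat \<Rightarrow> 'a \<Rightarrow> rvec) \<Rightarrow> rvec \<Rightarrow> nat \<Rightarrow> 'a \<Rightarrow> rvec"
where
  "state A Abar B Bbar w u x 0 \<omega> = x"
| "state A Abar B Bbar w u x (Suc k) \<omega> =
     (A *\<^sub>v state A Abar B Bbar w u x k \<omega> + B *\<^sub>v u k \<omega>) +
     w k \<omega> \<cdot>\<^sub>v (Abar *\<^sub>v state A Abar B Bbar w u x k \<omega> + Bbar *\<^sub>v u k \<omega>)"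

definition exactly_null_controllable ::
  "'a measure \<Rightarrow> (nat \<Rightarrow> 'a \<Rightarrow> real) \<Rightarrow> nat \<Rightarrow> nat \<Rightarrow> rmat \<Rightarrow> rmat \<Rightarrow> rmat \<Rightarrow> rmat \<Rightarrow> bool"
where
  "exactly_null_controllable P w n m A Abar B Bbar \<longleftrightarrow>
     (\<forall>x\<in>carrier_vec n. x \<noteq> 0\<^sub>v n \<longrightarrow>
       (\<exists>N>0. \<exists>u\<in>l2F P w N m. AE \<omega> in P. state A Abar B Bbar w u x (Suc N) \<omega> = 0\<^sub>v n))"

text \<open>
  The set of terminal values depends on the horizon \<open>N\<close>, because the backward equation is posed on
  \<open>[0, N]\<close> with terminal time \<open>N + 1\<close>.
\<close>
definition solvable_terminals ::
  "'a measure \<Rightarrow> (nat \<Rightarrow> 'a \<Rightarrow> real) \<Rightarrow> nat \<Rightarrow> rmat \<Rightarrow> rmat \<Rightarrow> nat \<Rightarrow> ('a \<Rightarrow> rvec) set"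
where
  "solvable_terminals P w n C Cbar N =
     {\<xi> \<in> L2 P n. \<exists>xt zt.
        (\<forall>k\<le>N. xt k \<in> L2 P n \<and> vec_measurable (past P w k) n (xt k) \<and>
                zt k \<in> L2 P n \<and> vec_measurable (past P w k) n (zt k)) \<and>
        xt (Suc N) = \<xi> \<and>
        (\<forall>k\<le>N. AE \<omega> in P.
           xt k \<omega> = C *\<^sub>v xt (Suc k) \<omega> + Cbar *\<^sub>v zt k \<omega> - w k \<omega> \<cdot>\<^sub>v (C *\<^sub>v zt k \<omega>))}"

text \<open>
  Since measurability with respect to \<open>F(N)\<close> and membership in the set above refer to the terminal
  time at which the target is to be attained, the horizon is chosen before the target.
\<close>
definition exactly_controllable ::
  "'a measure \<Rightarrow> (nat \<Rightarrow> 'a \<Rightarrow> real) \<Rightarrow> nat \<Rightarrow> nat \<Rightarrow> rmat \<Rightarrow> rmat \<Rightarrow> rmat \<Rightarrow> rmat \<Rightarrow> rmat \<Rightarrow> rmat \<Rightarrow> bool"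
where
  "exactly_controllable P w n m A Abar B Bbar C Cbar \<longleftrightarrow>
     (\<forall>x\<in>carrier_vec n. x \<noteq> 0\<^sub>v n \<longrightarrow>
       (\<exists>N>0. \<forall>\<xi>\<in>solvable_terminals P w n C Cbar N. vec_measurable (past P w (Suc N)) n \<xi> \<longrightarrow>
          (\<exists>u\<in>l2F P w N m. AE \<omega> in P. state A Abar B Bbar w u x (Suc N) \<omega> = \<xi> \<omega>)))"


subsection \<open>The Gramian and the rank criterion\<close>

text \<open>\<open>Cprod n C Cbar w i \<omega>\<close> is the product \<open>C(0) \<cdots> C(i - 1)\<close> with \<open>C(j) = C + w(j) Cbar\<close>.\<close>
primrec Cprod :: "nat \<Rightarrow> rmat \<Rightarrow> rmat \<Rightarrow> (nat \<Rightarrow> 'a \<Rightarrow> real) \<Rightarrow> nat \<Rightarrow> 'a \<Rightarrow> rmat" where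
  "Cprod n C Cbar w 0 \<omega> = 1\<^sub>m n"
| "Cprod n C Cbar w (Suc i) \<omega> = Cprod n C Cbar w i \<omega> * (C + w i \<omega> \<cdot>\<^sub>m Cbar)"

definition mat_expectation :: "'a measure \<Rightarrow> nat \<Rightarrow> nat \<Rightarrow> ('a \<Rightarrow> rmat) \<Rightarrow> rmat" where
  "mat_expectation P r c X = Matrix.mat r c (\<lambda>ij. \<integral>\<omega>. X \<omega> $$ ij \<partial>P)"

definition gramian ::
  "'a measure \<Rightarrow> (nat \<Rightarrow> 'a \<Rightarrow> real) \<Rightarrow> nat \<Rightarrow> rmat \<Rightarrow> rmat \<Rightarrow> rmat \<Rightarrow> nat \<Rightarrow> rmat"
where
  "gramian P w n C Cbar D N = Matrix.mat n n (\<lambda>ab. \<Sum>i=0..N.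
     mat_expectation P n n (\<lambda>\<omega>.
       Cprod n C Cbar w i \<omega> * D * transpose_mat D * transpose_mat (Cprod n C Cbar w i \<omega>)) $$ ab)"

inductive_set words :: "nat \<Rightarrow> rmat \<Rightarrow> rmat \<Rightarrow> rmat set" for n C Cbar where
  empty: "1\<^sub>m n \<in> words n C Cbar"
| C: "W \<in> words n C Cbar \<Longrightarrow> W * C \<in> words n C Cbar"
| Cbar: "W \<in> words n C Cbar \<Longrightarrow> W * Cbar \<in> words n C Cbar"

text \<open>
  The matrix \<open>R\<close> has infinitely many columns; it is represented by the set of its columns, and its
  rank is the dimension of their span, just as \<open>rank\<close> is defined for finite matrices.
\<close>
definition R_cols :: "nat \<Rightarrow> rmat \<Rightarrow> rmat \<Rightarrow> rmat \<Rightarrow> rvec set" where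
  "R_cols n C Cbar D = (\<Union>W\<in>words n C Cbar. set (cols (W * D)))"

definition (in vec_space) cols_rank :: "'a Matrix.vec set \<Rightarrow> nat" where
  "cols_rank S = vectorspace.dim class_ring (span_vs S)"

end

theory Submission
  imports Defs
begin

text \<open>
  Put \<open>K = A - L Abar\<close>, \<open>z = Abar x + Bbar u\<close> and \<open>u = M (p, v)\<close>. The system then reads
  \<open>x(k+1) = K x(k) + L z(k) + F v(k) + w(k) z(k)\<close>, that is
  \<open>x(k) = C x(k+1) + Cbar z(k) + D v(k) - w(k) C z(k)\<close>. For a vector \<open>a\<close> let
  \<open>p(k) = (C(0) \<cdots> C(k-1))\<^sup>T a\<close>. As \<open>w(k)\<close> has mean 0, variance 1 and is independent of the past,
  \<open>E[p(k) \<bullet> x(k)] - E[p(k+1) \<bullet> x(k+1)] = E[D\<^sup>T p(k) \<bullet> v(k)]\<close>, and the Gramian \<open>G\<^sub>N\<close> is the value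
  \<open>H(N+1)\<close> of the recursion \<open>H(0) = 0\<close>, \<open>H(j+1) = C H(j) C\<^sup>T + Cbar H(j) Cbar\<^sup>T + D D\<^sup>T\<close>. Hence the
  kernel of \<open>G\<^sub>N\<close> consists of the vectors orthogonal to all \<open>W D\<close> with \<open>W\<close> a word of length at most
  \<open>N\<close>, which gives the rank criterion.

  If \<open>a\<close> is orthogonal to all columns of \<open>R\<close>, then \<open>D\<^sup>T p(k) = 0\<close>, so \<open>E[p(k) \<bullet> x(k)]\<close> is constant
  and the initial state \<open>a\<close> cannot be steered to 0 unless \<open>a = 0\<close>. Conversely, if \<open>G\<^sub>N\<close> is
  invertible, take a solution \<open>(xt, zt)\<close> of the backward equation ending in the target and solve
  \<open>G\<^sub>N a = x - xt(0)\<close>. Then \<open>y(k) = H(N+1-k) p(k)\<close>, \<open>z(k) = H(N-k) Cbar\<^sup>T p(k)\<close>, \<open>v(k) = D\<^sup>T p(k)\<close>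
  is an adapted solution of the controlled backward equation running from \<open>x - xt(0)\<close> to 0, and
  adding it to \<open>(xt, zt)\<close> yields the required control.
\<close>

no_notation inner (infix "\<bullet>" 70)
no_notation vec_nth (infixl "$" 90)

section \<open>Independence of the noise from its past\<close>

lemma sets_past: "sets (past P w k) = sigma_sets (space P) (\<Union>i<k. {w i -` S \<inter> space P | S. S \<in> sets borel})"
  unfolding past_def by (rule sets_measure_of) auto

lemma space_past [simp]: "space (past P w k) = space P"
  unfolding past_def by (rule space_measure_of) auto

lemma measurable_past_Suc:
  assumes "f \<in> borel_measurable (past P w k)"
  shows "f \<in> borel_measurable (past P w (Suc k))"
proof -
  have "sets (past P w k) \<subseteq> sets (past P w (Suc k))"
    unfolding sets_past by (intro sigma_sets_mono') fastforce
  then show ?thesis using assms by (auto simp: measurable_def)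
qed

lemma noise_measurable_past: "w k \<in> borel_measurable (past P w (Suc k))"
  by (auto simp: measurable_def sets_past intro!: sigma_sets.Basic)

text \<open>The level set of \<open>f\<close> through \<open>x\<close> lies in the trivial
  \<sigma>-algebra and is nonempty, so it is the whole space. This will make the initial value of a
  backward solution deterministic.\<close>

lemma measurable_past_0_const:
  fixes f :: "'a \<Rightarrow> real"
  assumes "f \<in> borel_measurable (past P w 0)" "x \<in> space P" "y \<in> space P"
  shows "f x = f y"
proof -
  have "f -` {f x} \<inter> space P \<in> sets (past P w 0)"
    using measurable_sets[OF assms(1), of "{f x}"] by simp
  then have "f -` {f x} \<inter> space P \<in> {{}, space P}"
    by (simp add: sets_past sigma_sets_empty_eq)
  then have "y \<in> f -` {f x} \<inter> space P" using assms(2,3) by blast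
  then show ?thesis by simp
qed

locale noise_space = prob_space P for P :: "'a measure" +
  fixes w :: "nat \<Rightarrow> 'a \<Rightarrow> real"
  assumes iid: "iid_noise P w"
begin

lemma noise_measurable [measurable]: "w k \<in> borel_measurable P"
  using iid unfolding iid_noise_def indep_vars_def by auto

lemma measurable_past:
  assumes "f \<in> borel_measurable (past P w k)"
  shows "f \<in> borel_measurable P"
proof -
  have "sets (past P w k) \<subseteq> sets P"
    unfolding sets_past by (rule sets.sigma_sets_subset) (auto intro!: measurable_sets[OF noise_measurable])
  then show ?thesis using assms by (auto simp: measurable_def)
qed

text \<open>The index sets \<open>{k}\<close> and \<open>{..<k}\<close> are disjoint, so grouping
  the independent family along them gives independent \<sigma>-algebras. The function
  \<open>g\<close> is a parameter so that both \<open>w k\<close> and its square are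
  covered.\<close>

lemma noise_indep_past:
  assumes f: "f \<in> borel_measurable (past P w k)" and g: "g \<in> borel_measurable borel"
  shows "indep_var borel (\<lambda>\<omega>. g (w k \<omega>)) borel (f :: 'a \<Rightarrow> real)"
proof -
  define E where "E i = {w i -` S \<inter> space P | S. S \<in> sets borel}" for i
  define I where "I b = (if b then {k} else {..<k})" for b
  have "indep_vars (\<lambda>_. borel) w UNIV"
    using iid by (simp add: iid_noise_def)
  then have "indep_sets E UNIV"
    by (simp add: indep_vars_def2 E_def[abs_def])
  then have "indep_sets E (\<Union>b\<in>UNIV. I b)"
    by (rule indep_sets_mono_index[rotated]) auto
  \<comment> \<open>Independence passes from generators to generated \<sigma>-algebras when the
    generators are stable under intersection.\<close>
  moreover have "Int_stable (E i)" for i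
    unfolding E_def Int_stable_def by (auto, metis Int_assoc inf_left_commute sets.Int vimage_Int inf.idem)
  moreover have "disjoint_family_on I UNIV"
    by (auto simp: disjoint_family_on_def I_def)
  ultimately have ind: "indep_sets (\<lambda>b. sigma_sets (space P) (\<Union>i\<in>I b. E i)) UNIV"
    by (rule indep_sets_collect_sigma)
  have "indep_set (sigma_sets (space P) (E k)) (sets (past P w k))"
    unfolding indep_set_def using ind
    by (rule indep_sets_mono_sets) (auto simp: I_def sets_past E_def split: bool.splits)
  \<comment> \<open>Independence is inherited by subfamilies: preimages under \<open>g\<close> after
    \<open>w k\<close> are preimages under \<open>w k\<close>, and those under \<open>f\<close> lie
    in the past.\<close>
  then have "indep_set (sigma_sets (space P) {(\<lambda>\<omega>. g (w k \<omega>)) -` A \<inter> space P | A. A \<in> sets borel})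
      (sigma_sets (space P) {f -` A \<inter> space P | A. A \<in> sets borel})"
    unfolding indep_set_def
  proof (rule indep_sets_mono_sets, goal_cases)
    case (1 b)
    show ?case
    proof (cases b)
      case True
      have "{(\<lambda>\<omega>. g (w k \<omega>)) -` A \<inter> space P | A. A \<in> sets borel} \<subseteq> E k"
      proof safe
        fix A :: "real set" assume "A \<in> sets borel"
        then have "g -` A \<in> sets borel" using measurable_sets[OF g] by simp
        moreover have "(\<lambda>\<omega>. g (w k \<omega>)) -` A = w k -` (g -` A)" by auto
        ultimately show "(\<lambda>\<omega>. g (w k \<omega>)) -` A \<inter> space P \<in> E k" unfolding E_def by auto
      qed
      then show ?thesis using True by (simp add: sigma_sets_mono')
    next
      case False
      have "{f -` A \<inter> space P | A. A \<in> sets borel} \<subseteq> sets (past P w k)"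
        using measurable_sets[OF f] by auto
      then have "sigma_sets (space P) {f -` A \<inter> space P | A. A \<in> sets borel} \<subseteq> sets (past P w k)"
        using sets.sigma_sets_subset[of _ "past P w k"] by auto
      then show ?thesis using False by auto
    qed
  qed
  then show ?thesis
    using measurable_past[OF f] g by (simp add: indep_var_eq)
qed

lemma noise_mean: "integrable P (w k)" "expectation (w k) = 0"
  using iid by (auto simp: iid_noise_def)

lemma noise_square: "integrable P (\<lambda>\<omega>. (w k \<omega>)\<^sup>2)" "expectation (\<lambda>\<omega>. (w k \<omega>)\<^sup>2) = 1"
proof -
  have "variance (w k) = 1"
    using iid unfolding iid_noise_def by blast
  then show "expectation (\<lambda>\<omega>. (w k \<omega>)\<^sup>2) = 1"
    unfolding noise_mean by simp
  show "integrable P (\<lambda>\<omega>. (w k \<omega>)\<^sup>2)"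
    using iid by (simp add: iid_noise_def)
qed

text \<open>Expectations of independent integrable factors multiply. Plain integrability of
  \<open>f\<close> is the right assumption, since \<open>f\<close> will be a scalar product of
  square integrable processes.\<close>

lemma expectation_noise_mult:
  assumes "f \<in> borel_measurable (past P w k)" "integrable P f"
  shows "integrable P (\<lambda>\<omega>. w k \<omega> * f \<omega>)" "expectation (\<lambda>\<omega>. w k \<omega> * f \<omega>) = 0"
  using indep_var_integrable[OF noise_indep_past[OF assms(1), of "\<lambda>x. x"]]
    indep_var_lebesgue_integral[OF noise_indep_past[OF assms(1), of "\<lambda>x. x"]] assms(2) noise_mean[of k]
  by auto

lemma expectation_noise_square_mult:
  assumes "f \<in> borel_measurable (past P w k)" "integrable P f"
  shows "integrable P (\<lambda>\<omega>. (w k \<omega>)\<^sup>2 * f \<omega>)"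
    "expectation (\<lambda>\<omega>. (w k \<omega>)\<^sup>2 * f \<omega>) = expectation f"
  using indep_var_integrable[OF noise_indep_past[OF assms(1), of "\<lambda>x. x\<^sup>2"]]
    indep_var_lebesgue_integral[OF noise_indep_past[OF assms(1), of "\<lambda>x. x\<^sup>2"]] assms(2) noise_square[of k]
  by auto

end

section \<open>Rank and kernel criteria\<close>

lemma mult_mat_zero_vec: "(X :: rmat) \<in> carrier_mat r s \<Longrightarrow> X *\<^sub>v 0\<^sub>v s = 0\<^sub>v r"
  by auto

lemma zero_mat_mult_vec: "(v :: rvec) \<in> carrier_vec s \<Longrightarrow> 0\<^sub>m r s *\<^sub>v v = 0\<^sub>v r"
  by auto

lemma scalar_prod_self_nonneg: "0 \<le> (v :: rvec) \<bullet> v"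
  by (simp add: scalar_prod_def sum_nonneg)

lemma scalar_prod_self_eq_0_iff:
  fixes v :: rvec
  assumes "v \<in> carrier_vec n"
  shows "v \<bullet> v = 0 \<longleftrightarrow> v = 0\<^sub>v n"
  using assms by (auto simp: scalar_prod_def sum_nonneg_eq_0_iff vec_eq_iff)

lemma invertible_mat_iff_kernel:
  fixes G :: rmat
  assumes G: "G \<in> carrier_mat n n"
  shows "invertible_mat G \<longleftrightarrow> (\<forall>v\<in>carrier_vec n. G *\<^sub>v v = 0\<^sub>v n \<longrightarrow> v = 0\<^sub>v n)"
proof
  assume "invertible_mat G"
  then obtain B where B: "G * B = 1\<^sub>m n" "B * G = 1\<^sub>m (dim_row B)"
    using G by (auto simp: invertible_mat_def inverts_mat_def)
  \<comment> \<open>\<open>inverts_mat\<close> leaves the shape of \<open>B\<close> open; it is read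
    off from the two products.\<close>
  have Bc: "B \<in> carrier_mat n n"
    using B G by (metis carrier_matD(2) carrier_mat_triv index_mult_mat(2,3) index_one_mat(3))
  show "\<forall>v\<in>carrier_vec n. G *\<^sub>v v = 0\<^sub>v n \<longrightarrow> v = 0\<^sub>v n"
  proof safe
    fix v assume v: "v \<in> carrier_vec n" "G *\<^sub>v v = 0\<^sub>v n"
    have "v = (B * G) *\<^sub>v v" using B Bc v by simp
    also have "\<dots> = B *\<^sub>v (G *\<^sub>v v)" using G Bc v by (intro assoc_mult_mat_vec)
    finally show "v = 0\<^sub>v n" using v Bc by auto
  qed
next
  assume "\<forall>v\<in>carrier_vec n. G *\<^sub>v v = 0\<^sub>v n \<longrightarrow> v = 0\<^sub>v n"
  then have "det G \<noteq> 0" using det_0_iff_vec_prod_zero[OF G] by blast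
  from det_non_zero_imp_unit[OF G this] show "invertible_mat G"
    using G by (auto simp: Units_def ring_mat_simps invertible_mat_def inverts_mat_def) 
qed

section \<open>Rank of a possibly infinite set of columns\<close>

context vec_space
begin

text \<open>Independent subsets have at most \<open>n\<close> elements, so a maximal one exists, and
  by maximality it spans \<open>S\<close>. This reduces the rank of infinitely many columns to that
  of a finite matrix.\<close>

lemma finite_subset_same_span:
  assumes S: "S \<subseteq> carrier_vec n"
  obtains U where "U \<subseteq> S" "finite U" "card U \<le> n" "span U = span S"
proof -
  have "\<exists>A. finite A \<and> maximal A (\<lambda>T. T \<subseteq> S \<and> lin_indpt T)"
  proof (rule maximal_exists[where N = n and B = "{}"])
    fix A assume A: "A \<subseteq> S \<and> lin_indpt A"
    then show "finite A \<and> card A \<le> n"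
      using li_le_dim[OF fin_dim, of A] S dim_is_n by auto
  next
    show "{} \<subseteq> S \<and> lin_indpt {}" by (simp add: finite_lin_indpt2)
  qed
  then obtain U where fin: "finite U" and max: "maximal U (\<lambda>T. T \<subseteq> S \<and> lin_indpt T)" by auto
  then have U: "U \<subseteq> S" "lin_indpt U" by (auto simp: maximal_def)
  have Uc: "U \<subseteq> carrier_vec n" using U S by auto
  have "S \<subseteq> span U"
  proof
    fix s assume s: "s \<in> S"
    show "s \<in> span U"
    proof (rule ccontr)
      assume ns: "s \<notin> span U"
      then have "lin_indpt (insert s U)"
        using lin_dep_iff_in_span[of U s] U Uc s S span_mem[of U s] by (auto simp: module_vec_simps)
      with max s U ns show False
        unfolding maximal_def using span_mem[of U s] Uc by (metis insert_subset insertI1 module_vec_simps(3) subset_insertI)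
    qed
  qed
  then have "span U = span S"
    using span_is_monotone[OF U(1)] span_subsetI[OF Uc] span_span[OF Uc] 
    by (metis S Uc span_is_submodule span_is_subset module_vec_simps(3) subset_antisym)
  moreover have "card U \<le> n" using li_le_dim[OF fin_dim, of U] U Uc dim_is_n by auto
  ultimately show thesis using that U fin by blast
qed

end

text \<open>Full rank of a square matrix built from a spanning subset means that its transpose has
  trivial kernel. The version with a finite \<open>U\<close> is what later yields one common horizon
  for all columns.\<close>

lemma cols_rank_eq_iff:
  fixes S :: "rvec set"
  assumes S: "S \<subseteq> carrier_vec n"
  shows "vec_space.cols_rank n S = n \<longleftrightarrow>
    (\<exists>U. finite U \<and> U \<subseteq> S \<and> (\<forall>a\<in>carrier_vec n. (\<forall>c\<in>U. a \<bullet> c = 0) \<longrightarrow> a = 0\<^sub>v n))"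
    and "vec_space.cols_rank n S = n \<longleftrightarrow> (\<forall>a\<in>carrier_vec n. (\<forall>c\<in>S. a \<bullet> c = 0) \<longrightarrow> a = 0\<^sub>v n)"
proof -
  interpret vec_space "TYPE(real)" n .
  let ?l = "cols_rank S = n"
  obtain U where U: "U \<subseteq> S" "finite U" "card U \<le> n" and sp: "span U = span S"
    using finite_subset_same_span[OF S] .
  have Uc: "U \<subseteq> carrier_vec n" using U S by auto
  obtain xs where xs: "set xs = U" "length xs = card U"
    using finite_distinct_list[OF U(2)] distinct_card by metis
  \<comment> \<open>Zero columns do not change the span and make \<open>A\<close> square, so that
    the determinant test for full rank applies.\<close>
  define ys where "ys = xs @ replicate (n - card U) (0\<^sub>v n)"
  define A where "A = mat_of_cols n ys"
  have ys: "length ys = n" "set ys \<subseteq> insert (0\<^sub>v n) U" "U \<subseteq> set ys"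
    using xs U by (auto simp: ys_def)
  have A: "A \<in> carrier_mat n n" using ys by (auto simp: A_def)
  have cA: "cols A = ys" unfolding A_def using ys Uc by (intro cols_mat_of_cols) auto
  have ysc: "set ys \<subseteq> carrier_vec n" using ys Uc by auto
  have "span (set ys) = span U"
  proof
    show "span U \<subseteq> span (set ys)" by (rule span_is_monotone[OF ys(3)])
    have "0\<^sub>v n \<in> span U" using span_is_submodule Uc unfolding submodule_def by (auto simp: module_vec_simps)
    then have "set ys \<subseteq> span U" using ys(2) in_own_span[of U] Uc by auto
    then show "span (set ys) \<subseteq> span U"
      using span_is_subset[of "set ys" "span U"] span_is_submodule Uc by auto
  qed
  then have "cols_rank S = rank A" by (simp add: cols_rank_def rank_def cA sp)
  then have "?l \<longleftrightarrow> det (transpose_mat A) \<noteq> 0" using det_rank_iff[OF A] det_transpose[OF A] by simp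
  also have "\<dots> \<longleftrightarrow> (\<forall>a\<in>carrier_vec n. transpose_mat A *\<^sub>v a = 0\<^sub>v n \<longrightarrow> a = 0\<^sub>v n)"
    using det_0_iff_vec_prod_zero[of "transpose_mat A" n] A by auto
  also have "\<dots> \<longleftrightarrow> (\<forall>a\<in>carrier_vec n. (\<forall>c\<in>U. a \<bullet> c = 0) \<longrightarrow> a = 0\<^sub>v n)"
  proof (intro ball_cong refl imp_cong)
    fix a :: rvec assume a: "a \<in> carrier_vec n"
    have "transpose_mat A *\<^sub>v a = 0\<^sub>v n \<longleftrightarrow> (\<forall>i<n. ys ! i \<bullet> a = 0)"
      using A cA ys by (auto simp: vec_eq_iff mult_mat_vec_def row_transpose cols_nth[symmetric] simp del: cols_nth)
    also have "\<dots> \<longleftrightarrow> (\<forall>c\<in>set ys. c \<bullet> a = 0)" using ys(1) by (metis in_set_conv_nth)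
    also have "\<dots> \<longleftrightarrow> (\<forall>c\<in>set ys. a \<bullet> c = 0)" using comm_scalar_prod[OF a] ysc by (metis subsetD)
    also have "\<dots> \<longleftrightarrow> (\<forall>c\<in>U. a \<bullet> c = 0)" using ys(2,3) a by (auto intro!: scalar_prod_right_zero)
    finally show "transpose_mat A *\<^sub>v a = 0\<^sub>v n \<longleftrightarrow> (\<forall>c\<in>U. a \<bullet> c = 0)" .
  qed
  finally have l: "?l \<longleftrightarrow> (\<forall>a\<in>carrier_vec n. (\<forall>c\<in>U. a \<bullet> c = 0) \<longrightarrow> a = 0\<^sub>v n)" .
  \<comment> \<open>Orthogonality to a set depends only on its span, and \<open>S\<close> and
    \<open>U\<close> span the same space.\<close>
  have perp: "(\<forall>c\<in>S. a \<bullet> c = 0) \<longleftrightarrow> (\<forall>c\<in>U. a \<bullet> c = 0)" if "a \<in> carrier_vec n" for a :: rvec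
    using in_orthogonal_complement_span[OF S] in_orthogonal_complement_span[OF Uc] that
    unfolding sp orthogonal_complement_def by auto
  show "?l \<longleftrightarrow> (\<forall>a\<in>carrier_vec n. (\<forall>c\<in>S. a \<bullet> c = 0) \<longrightarrow> a = 0\<^sub>v n)"
    using l perp by auto
  then show "?l \<longleftrightarrow>
    (\<exists>U. finite U \<and> U \<subseteq> S \<and> (\<forall>a\<in>carrier_vec n. (\<forall>c\<in>U. a \<bullet> c = 0) \<longrightarrow> a = 0\<^sub>v n))"
    using l U perp by (meson subsetD)
qed

section \<open>Linear algebra of the Gramian recursion\<close>

locale gramian_system =
  fixes n q :: nat and C Cbar D :: rmat
  assumes C_carrier [simp]: "C \<in> carrier_mat n n"
    and Cbar_carrier [simp]: "Cbar \<in> carrier_mat n n"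
    and D_carrier [simp]: "D \<in> carrier_mat n q"
begin

text \<open>The recursion peels off the leftmost factor \<open>C(0)\<close>: averaging
  \<open>C(0) H C(0)\<^sup>T\<close> over a noise of mean 0 and variance 1 gives the terms with
  \<open>C\<close> and with \<open>Cbar\<close>. The index counts summands, so it is one ahead of
  the index of \<open>gramian\<close>.\<close>

primrec gram :: "nat \<Rightarrow> rmat" where
  "gram 0 = 0\<^sub>m n n"
| "gram (Suc j) = C * gram j * C\<^sup>T + Cbar * gram j * Cbar\<^sup>T + D * D\<^sup>T"

text \<open>Recursive form of: \<open>a\<close> is orthogonal to all columns of \<open>W * D\<close>
  for words \<open>W\<close> with fewer than \<open>j\<close> factors.\<close>

primrec unobservable :: "nat \<Rightarrow> rvec \<Rightarrow> bool" where
  "unobservable 0 a \<longleftrightarrow> True"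
| "unobservable (Suc j) a \<longleftrightarrow>
     D\<^sup>T *\<^sub>v a = 0\<^sub>v q \<and> unobservable j (C\<^sup>T *\<^sub>v a) \<and> unobservable j (Cbar\<^sup>T *\<^sub>v a)"

lemma transpose_carriers [simp]:
  "C\<^sup>T \<in> carrier_mat n n" "Cbar\<^sup>T \<in> carrier_mat n n" "D\<^sup>T \<in> carrier_mat q n"
  by auto

lemma mult_vec_carriers [simp]:
  "v \<in> carrier_vec n \<Longrightarrow> C *\<^sub>v v \<in> carrier_vec n" "v \<in> carrier_vec n \<Longrightarrow> Cbar *\<^sub>v v \<in> carrier_vec n"
  "v \<in> carrier_vec n \<Longrightarrow> C\<^sup>T *\<^sub>v v \<in> carrier_vec n" "v \<in> carrier_vec n \<Longrightarrow> Cbar\<^sup>T *\<^sub>v v \<in> carrier_vec n"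
  "v \<in> carrier_vec q \<Longrightarrow> D *\<^sub>v v \<in> carrier_vec n" "v \<in> carrier_vec n \<Longrightarrow> D\<^sup>T *\<^sub>v v \<in> carrier_vec q"
  by (auto intro!: mult_mat_vec_carrier)

lemmas mult_vec_add =
  mult_add_distrib_mat_vec[OF C_carrier] mult_add_distrib_mat_vec[OF Cbar_carrier]
  mult_add_distrib_mat_vec[OF D_carrier] mult_add_distrib_mat_vec[OF transpose_carriers(1)]
  mult_add_distrib_mat_vec[OF transpose_carriers(2)] mult_add_distrib_mat_vec[OF transpose_carriers(3)]

lemmas mult_vec_smult =
  mult_mat_vec[OF C_carrier] mult_mat_vec[OF Cbar_carrier] mult_mat_vec[OF D_carrier]
  mult_mat_vec[OF transpose_carriers(1)] mult_mat_vec[OF transpose_carriers(2)]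
  mult_mat_vec[OF transpose_carriers(3)]

lemma mult_vec_zero [simp]:
  "C *\<^sub>v 0\<^sub>v n = 0\<^sub>v n" "Cbar *\<^sub>v 0\<^sub>v n = 0\<^sub>v n" "D *\<^sub>v 0\<^sub>v q = 0\<^sub>v n"
  by (rule mult_mat_zero_vec, simp)+

lemma gram_carrier [simp]: "gram j \<in> carrier_mat n n"
proof (induction j)
  case (Suc j)
  have "D * D\<^sup>T \<in> carrier_mat n n" by (rule mult_carrier_mat[of _ _ q]) auto
  then show ?case by simp
qed simp

lemma gram_mult_vec_carrier [simp]: "v \<in> carrier_vec n \<Longrightarrow> gram j *\<^sub>v v \<in> carrier_vec n"
  by (auto intro!: mult_mat_vec_carrier)

lemma gram_Suc_mult_vec:
  assumes "a \<in> carrier_vec n"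
  shows "gram (Suc j) *\<^sub>v a =
    C *\<^sub>v (gram j *\<^sub>v (C\<^sup>T *\<^sub>v a)) + Cbar *\<^sub>v (gram j *\<^sub>v (Cbar\<^sup>T *\<^sub>v a)) + D *\<^sub>v (D\<^sup>T *\<^sub>v a)"
proof -
  have c: "C * gram j \<in> carrier_mat n n" "Cbar * gram j \<in> carrier_mat n n"
    "C * gram j * C\<^sup>T \<in> carrier_mat n n" "Cbar * gram j * Cbar\<^sup>T \<in> carrier_mat n n"
    by (auto intro!: mult_carrier_mat[of _ n n])
  have d: "D * D\<^sup>T \<in> carrier_mat n n" by (rule mult_carrier_mat[of _ _ q]) auto
  show ?thesis
    using assms c d
    by (simp add: add_mult_distrib_mat_vec[of _ n n] assoc_mult_mat_vec[of _ n n _ n]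
        assoc_mult_mat_vec[of D n q _ n] add_carrier_mat)
qed

text \<open>The left factors \<open>C\<close>, \<open>Cbar\<close>, \<open>D\<close> move over to
  \<open>a\<close> as transposes. The case \<open>a = b\<close> gives positivity; two different
  vectors are kept in order to recover matrix entries.\<close>

lemma gram_quadratic_form:
  assumes a: "a \<in> carrier_vec n" and b: "b \<in> carrier_vec n"
  shows "a \<bullet> (gram (Suc j) *\<^sub>v b) = (C\<^sup>T *\<^sub>v a) \<bullet> (gram j *\<^sub>v (C\<^sup>T *\<^sub>v b)) +
    (Cbar\<^sup>T *\<^sub>v a) \<bullet> (gram j *\<^sub>v (Cbar\<^sup>T *\<^sub>v b)) + (D\<^sup>T *\<^sub>v a) \<bullet> (D\<^sup>T *\<^sub>v b)"
  unfolding gram_Suc_mult_vec[OF b] using a b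
  by (simp add: scalar_prod_add_distrib[of _ n] transpose_vec_mult_scalar[OF C_carrier _ a]
      transpose_vec_mult_scalar[OF Cbar_carrier _ a] transpose_vec_mult_scalar[OF D_carrier _ a])

lemma gram_nonneg: "a \<in> carrier_vec n \<Longrightarrow> 0 \<le> a \<bullet> (gram j *\<^sub>v a)"
proof (induction j arbitrary: a)
  case (Suc j)
  then show ?case
    using scalar_prod_self_nonneg[of "D\<^sup>T *\<^sub>v a"] by (simp add: gram_quadratic_form del: gram.simps)
qed (simp add: zero_mat_mult_vec)

text \<open>By \<open>gram_nonneg\<close> the quadratic form is a sum of three nonnegative terms, so
  each of them vanishes.\<close>

lemma unobservable_if_gram_zero:
  "a \<in> carrier_vec n \<Longrightarrow> a \<bullet> (gram j *\<^sub>v a) = 0 \<Longrightarrow> unobservable j a"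
proof (induction j arbitrary: a)
  case (Suc j)
  have "a \<bullet> (gram (Suc j) *\<^sub>v a) = 0" using Suc.prems by simp
  then have "(C\<^sup>T *\<^sub>v a) \<bullet> (gram j *\<^sub>v (C\<^sup>T *\<^sub>v a)) = 0 \<and>
      (Cbar\<^sup>T *\<^sub>v a) \<bullet> (gram j *\<^sub>v (Cbar\<^sup>T *\<^sub>v a)) = 0 \<and> (D\<^sup>T *\<^sub>v a) \<bullet> (D\<^sup>T *\<^sub>v a) = 0"
    using Suc.prems(1) gram_nonneg[of "C\<^sup>T *\<^sub>v a" j] gram_nonneg[of "Cbar\<^sup>T *\<^sub>v a" j]
      scalar_prod_self_nonneg[of "D\<^sup>T *\<^sub>v a"]
    unfolding gram_quadratic_form[OF Suc.prems(1) Suc.prems(1)] by simp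
  then show ?case
    using Suc.IH Suc.prems(1) scalar_prod_self_eq_0_iff[of "D\<^sup>T *\<^sub>v a" q] by simp
qed simp

lemma gram_zero_if_unobservable:
  "a \<in> carrier_vec n \<Longrightarrow> unobservable j a \<Longrightarrow> gram j *\<^sub>v a = 0\<^sub>v n"
proof (induction j arbitrary: a)
  case (Suc j)
  then have "gram j *\<^sub>v (C\<^sup>T *\<^sub>v a) = 0\<^sub>v n" "gram j *\<^sub>v (Cbar\<^sup>T *\<^sub>v a) = 0\<^sub>v n" "D\<^sup>T *\<^sub>v a = 0\<^sub>v q"
    by auto
  then show ?case
    unfolding gram_Suc_mult_vec[OF Suc.prems(1)]
    by simp
qed auto

lemma invertible_gram_iff:
  "invertible_mat (gram j) \<longleftrightarrow> (\<forall>a\<in>carrier_vec n. unobservable j a \<longrightarrow> a = 0\<^sub>v n)"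
proof -
  have "gram j *\<^sub>v a = 0\<^sub>v n \<longleftrightarrow> unobservable j a" if "a \<in> carrier_vec n" for a
    using that gram_zero_if_unobservable unobservable_if_gram_zero[of a j] by auto
  then show ?thesis by (simp add: invertible_mat_iff_kernel[of _ n])
qed

text \<open>Together with \<open>unobservable_smult\<close> this makes the unobservable vectors a
  subspace, which therefore contains random combinations of \<open>C\<^sup>T *\<^sub>v a\<close> and
  \<open>Cbar\<^sup>T *\<^sub>v a\<close> once it contains both vectors.\<close>

lemma unobservable_add:
  "a \<in> carrier_vec n \<Longrightarrow> b \<in> carrier_vec n \<Longrightarrow> unobservable j a \<Longrightarrow> unobservable j b \<Longrightarrow>
    unobservable j (a + b)"
  by (induction j arbitrary: a b) (auto simp: mult_vec_add)

lemma unobservable_smult: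
  "a \<in> carrier_vec n \<Longrightarrow> unobservable j a \<Longrightarrow> unobservable j (t \<cdot>\<^sub>v a)"
  by (induction j arbitrary: a) (auto simp: mult_vec_smult)

lemma unobservable_mono: "unobservable (j + i) a \<Longrightarrow> unobservable j a"
  by (induction j arbitrary: a) auto

section \<open>Words in \<open>C\<close> and \<open>Cbar\<close> and the rank criterion\<close>

lemma words_carrier: "W \<in> words n C Cbar \<Longrightarrow> W \<in> carrier_mat n n"
  by (induction rule: words.induct) auto

lemma transpose_mult_mult_vec:
  fixes W X :: rmat
  assumes "W \<in> carrier_mat n n" "X \<in> carrier_mat n r" "a \<in> carrier_vec n"
  shows "(W * X)\<^sup>T *\<^sub>v a = X\<^sup>T *\<^sub>v (W\<^sup>T *\<^sub>v a)"
  using assms by (simp add: transpose_mult[of W n n X r] assoc_mult_mat_vec[of "X\<^sup>T" r n "W\<^sup>T" n])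

text \<open>The witness \<open>l\<close> is the length of \<open>W\<close>: every factor uses up one
  step of the horizon. Words grow on the right, so the transpose of the new factor acts last, and
  the induction hypothesis is applied with horizon \<open>Suc j\<close>.\<close>

lemma unobservable_word:
  assumes "W \<in> words n C Cbar"
  shows "\<exists>l. \<forall>a\<in>carrier_vec n. \<forall>j. unobservable (j + l) a \<longrightarrow> unobservable j (W\<^sup>T *\<^sub>v a)"
  using assms
proof induction
  case empty
  show ?case by (intro exI[of _ 0]) simp
next
  case (C W)
  then obtain l where l: "\<And>a j. a \<in> carrier_vec n \<Longrightarrow> unobservable (j + l) a \<Longrightarrow> unobservable j (W\<^sup>T *\<^sub>v a)"
    by blast
  show ?case
  proof (intro exI[of _ "Suc l"] ballI allI impI)
    fix a j assume "a \<in> carrier_vec n" "unobservable (j + Suc l) a"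
    then show "unobservable j ((W * C)\<^sup>T *\<^sub>v a)"
      using l[of a "Suc j"] words_carrier[OF C.hyps]
      by (simp add: transpose_mult_mult_vec[OF _ C_carrier])
  qed
next
  case (Cbar W)
  then obtain l where l: "\<And>a j. a \<in> carrier_vec n \<Longrightarrow> unobservable (j + l) a \<Longrightarrow> unobservable j (W\<^sup>T *\<^sub>v a)"
    by blast
  show ?case
  proof (intro exI[of _ "Suc l"] ballI allI impI)
    fix a j assume "a \<in> carrier_vec n" "unobservable (j + Suc l) a"
    then show "unobservable j ((W * Cbar)\<^sup>T *\<^sub>v a)"
      using l[of a "Suc j"] words_carrier[OF Cbar.hyps]
      by (simp add: transpose_mult_mult_vec[OF _ Cbar_carrier])
  qed
qed

lemma orthogonal_cols_iff:
  assumes W: "W \<in> carrier_mat n n" and a: "a \<in> carrier_vec n"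
  shows "(\<forall>c\<in>set (cols (W * D)). a \<bullet> c = 0) \<longleftrightarrow> D\<^sup>T *\<^sub>v (W\<^sup>T *\<^sub>v a) = 0\<^sub>v q"
proof -
  have WD: "W * D \<in> carrier_mat n q" using W by auto
  have "(\<forall>c\<in>set (cols (W * D)). a \<bullet> c = 0) \<longleftrightarrow> (\<forall>i<q. a \<bullet> col (W * D) i = 0)"
    using WD by (auto simp: cols_def)
  also have "\<dots> \<longleftrightarrow> (\<forall>i<q. col (W * D) i \<bullet> a = 0)"
    using comm_scalar_prod[OF a] col_carrier_vec WD by (metis carrier_matD(2))
  also have "\<dots> \<longleftrightarrow> (W * D)\<^sup>T *\<^sub>v a = 0\<^sub>v q"
    using WD by (auto simp: vec_eq_iff)
  finally show ?thesis using transpose_mult_mult_vec[OF W D_carrier a] by simp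
qed

lemma R_cols_carrier: "R_cols n C Cbar D \<subseteq> carrier_vec n"
proof -
  have "W * D \<in> carrier_mat n q" if "W \<in> words n C Cbar" for W
    using words_carrier[OF that] by auto
  then show ?thesis unfolding R_cols_def using cols_dim by blast
qed

text \<open>A column comes from a single word, so a finite horizon suffices for it: the length of
  the word, plus one step for \<open>D\<^sup>T\<close>.\<close>

lemma unobservable_imp_orthogonal:
  assumes "c \<in> R_cols n C Cbar D"
  obtains l where "\<And>a. a \<in> carrier_vec n \<Longrightarrow> unobservable l a \<Longrightarrow> a \<bullet> c = 0"
proof -
  obtain W where W: "W \<in> words n C Cbar" "c \<in> set (cols (W * D))"
    using assms by (auto simp: R_cols_def)
  obtain l where l: "\<And>a j. a \<in> carrier_vec n \<Longrightarrow> unobservable (j + l) a \<Longrightarrow> unobservable j (W\<^sup>T *\<^sub>v a)"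
    using unobservable_word[OF W(1)] by blast
  have "a \<bullet> c = 0" if "a \<in> carrier_vec n" "unobservable (Suc l) a" for a
    using l[of a 1] that orthogonal_cols_iff[OF words_carrier[OF W(1)], of a] W(2) by auto
  then show thesis using that by blast
qed

lemma orthogonal_imp_unobservable:
  assumes a: "a \<in> carrier_vec n" and orth: "\<forall>c\<in>R_cols n C Cbar D. a \<bullet> c = 0"
  shows "unobservable j a"
proof -
  have D: "D\<^sup>T *\<^sub>v (W\<^sup>T *\<^sub>v a) = 0\<^sub>v q" if "W \<in> words n C Cbar" for W
    using orthogonal_cols_iff[OF words_carrier[OF that] a] orth that by (auto simp: R_cols_def)
  \<comment> \<open>Generalising from \<open>a\<close> to all \<open>W\<^sup>T *\<^sub>v a\<close>
    lets the induction on \<open>j\<close> extend \<open>W\<close> by either letter.\<close>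
  have "unobservable j (W\<^sup>T *\<^sub>v a)" if "W \<in> words n C Cbar" for W
    using that
  proof (induction j arbitrary: W)
    case (Suc j)
    then show ?case
      using D[OF Suc.prems] Suc.IH[OF words.C[OF Suc.prems]] Suc.IH[OF words.Cbar[OF Suc.prems]]
        words_carrier[OF Suc.prems] a
      by (simp add: transpose_mult_mult_vec[OF _ C_carrier] transpose_mult_mult_vec[OF _ Cbar_carrier])
  qed simp
  from this[OF words.empty] show ?thesis using a by simp
qed

lemma cols_rank_iff_orthogonal:
  "vec_space.cols_rank n (R_cols n C Cbar D) = n \<longleftrightarrow>
    (\<forall>a\<in>carrier_vec n. (\<forall>j. unobservable j a) \<longrightarrow> a = 0\<^sub>v n)"
  unfolding cols_rank_eq_iff(2)[OF R_cols_carrier]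
  using orthogonal_imp_unobservable unobservable_imp_orthogonal by meson

text \<open>Finitely many columns already witness full rank, and each is controlled at a finite
  horizon, so one horizon serves for all.\<close>

lemma cols_rank_iff_gram:
  "vec_space.cols_rank n (R_cols n C Cbar D) = n \<longleftrightarrow> (\<exists>N>0. invertible_mat (gram (Suc N)))"
proof
  assume "\<exists>N>0. invertible_mat (gram (Suc N))"
  then show "vec_space.cols_rank n (R_cols n C Cbar D) = n"
    unfolding cols_rank_iff_orthogonal invertible_gram_iff by blast
next
  assume "vec_space.cols_rank n (R_cols n C Cbar D) = n"
  then obtain U where U: "finite U" "U \<subseteq> R_cols n C Cbar D"
    "\<And>a. a \<in> carrier_vec n \<Longrightarrow> (\<forall>c\<in>U. a \<bullet> c = 0) \<Longrightarrow> a = 0\<^sub>v n"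
    using cols_rank_eq_iff(1)[OF R_cols_carrier] by auto
  have "\<exists>l. \<forall>a\<in>carrier_vec n. unobservable l a \<longrightarrow> a \<bullet> c = 0" if "c \<in> U" for c
    using unobservable_imp_orthogonal[of c] that U(2) by (metis subsetD)
  then obtain l where l: "\<And>c a. c \<in> U \<Longrightarrow> a \<in> carrier_vec n \<Longrightarrow> unobservable (l c) a \<Longrightarrow> a \<bullet> c = 0"
    by metis
  \<comment> \<open>The sum bounds every \<open>l c\<close> because \<open>U\<close> is finite; the
    successor makes \<open>N\<close> positive.\<close>
  define N where "N = Suc (\<Sum>c\<in>U. l c)"
  have "invertible_mat (gram (Suc N))"
    unfolding invertible_gram_iff
  proof (intro ballI impI)
    fix a assume a: "a \<in> carrier_vec n" "unobservable (Suc N) a"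
    have "a \<bullet> c = 0" if c: "c \<in> U" for c
    proof -
      have "l c \<le> Suc N" unfolding N_def using member_le_sum[of c U l] U(1) c by simp
      then have "unobservable (l c) a" using unobservable_mono[of "l c" "Suc N - l c" a] a by simp
      then show ?thesis using l c a by blast
    qed
    then show "a = 0\<^sub>v n" using U(3) a by blast
  qed
  then show "\<exists>N>0. invertible_mat (gram (Suc N))" unfolding N_def by blast
qed

end

section \<open>Square integrable adapted processes\<close>

context noise_space
begin

definition past_L2 :: "nat \<Rightarrow> ('a \<Rightarrow> real) \<Rightarrow> bool" where
  "past_L2 k f \<longleftrightarrow> f \<in> borel_measurable (past P w k) \<and> integrable P (\<lambda>\<omega>. (f \<omega>)\<^sup>2)"

lemma past_L2_cong: "(\<And>\<omega>. \<omega> \<in> space P \<Longrightarrow> f \<omega> = g \<omega>) \<Longrightarrow> past_L2 k f \<longleftrightarrow> past_L2 k g"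
  unfolding past_L2_def
  by (intro conj_cong Bochner_Integration.integrable_cong measurable_cong) auto

text \<open>The product is dominated by the sum of the two squares.\<close>

lemma past_L2_mult_integrable:
  assumes "past_L2 k f" "past_L2 k g"
  shows "integrable P (\<lambda>\<omega>. f \<omega> * g \<omega>)"
proof (rule Bochner_Integration.integrable_bound)
  show "integrable P (\<lambda>\<omega>. (f \<omega>)\<^sup>2 + (g \<omega>)\<^sup>2)"
    using assms by (simp add: past_L2_def)
  show "(\<lambda>\<omega>. f \<omega> * g \<omega>) \<in> borel_measurable P"
    using assms measurable_past unfolding past_L2_def by (intro borel_measurable_times) auto
  have "\<bar>a * b\<bar> \<le> a\<^sup>2 + b\<^sup>2" for a b :: real
  proof -
    have "2 * \<bar>a * b\<bar> \<le> a\<^sup>2 + b\<^sup>2"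
      using sum_squares_bound[of "\<bar>a\<bar>" "\<bar>b\<bar>"] by (simp add: abs_mult)
    then show ?thesis using abs_ge_zero[of "a * b"] by linarith
  qed
  then show "AE \<omega> in P. norm (f \<omega> * g \<omega>) \<le> norm ((f \<omega>)\<^sup>2 + (g \<omega>)\<^sup>2)"
    by simp
qed

lemma past_L2_const: "past_L2 k (\<lambda>_. c)"
  by (simp add: past_L2_def)

lemma past_L2_cmult: "past_L2 k f \<Longrightarrow> past_L2 k (\<lambda>\<omega>. c * f \<omega>)"
  by (auto simp: past_L2_def power_mult_distrib)

lemma past_L2_add:
  assumes "past_L2 k f" "past_L2 k g"
  shows "past_L2 k (\<lambda>\<omega>. f \<omega> + g \<omega>)"
  using assms past_L2_mult_integrable[OF assms]
  by (auto simp: past_L2_def power2_sum mult.assoc)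

lemma past_L2_sum:
  "finite I \<Longrightarrow> (\<And>i. i \<in> I \<Longrightarrow> past_L2 k (f i)) \<Longrightarrow> past_L2 k (\<lambda>\<omega>. \<Sum>i\<in>I. f i \<omega>)"
  by (induction I rule: finite_induct) (auto simp: past_L2_const past_L2_add)

text \<open>Square integrability of \<open>w k * g\<close> rests on independence: the square of the
  noise is independent of the square of \<open>g\<close>. Measurability moves one step ahead because
  \<open>w k\<close> itself enters.\<close>

lemma past_L2_step:
  assumes f: "past_L2 k f" and g: "past_L2 k g"
  shows "past_L2 (Suc k) (\<lambda>\<omega>. f \<omega> + w k \<omega> * g \<omega>)"
proof (rule past_L2_add)
  show "past_L2 (Suc k) f"
    using f measurable_past_Suc by (auto simp: past_L2_def)
  have "(\<lambda>\<omega>. (g \<omega>)\<^sup>2) \<in> borel_measurable (past P w k)"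
    using g by (auto simp: past_L2_def)
  then have "integrable P (\<lambda>\<omega>. (w k \<omega>)\<^sup>2 * (g \<omega>)\<^sup>2)"
    using expectation_noise_square_mult(1) g by (auto simp: past_L2_def)
  moreover have "(\<lambda>\<omega>. w k \<omega> * g \<omega>) \<in> borel_measurable (past P w (Suc k))"
    using g unfolding past_L2_def
    by (intro borel_measurable_times noise_measurable_past measurable_past_Suc) (rule conjunct1)
  ultimately show "past_L2 (Suc k) (\<lambda>\<omega>. w k \<omega> * g \<omega>)"
    by (simp add: past_L2_def power_mult_distrib)
qed

definition L2F :: "nat \<Rightarrow> nat \<Rightarrow> ('a \<Rightarrow> rvec) set" where
  "L2F k s = {X \<in> L2 P s. vec_measurable (past P w k) s X}"

text \<open>The squared norm is the sum of the squared coordinates and dominates each of them. All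
  closure properties below are proved coordinatewise through this equivalence.\<close>

lemma L2F_iff:
  "X \<in> L2F k s \<longleftrightarrow> (\<forall>\<omega>\<in>space P. X \<omega> \<in> carrier_vec s) \<and> (\<forall>i<s. past_L2 k (\<lambda>\<omega>. X \<omega> $ i))"
proof -
  have "integrable P (\<lambda>\<omega>. X \<omega> \<bullet> X \<omega>) \<longleftrightarrow> (\<forall>i<s. integrable P (\<lambda>\<omega>. (X \<omega> $ i)\<^sup>2))"
    if car: "\<forall>\<omega>\<in>space P. X \<omega> \<in> carrier_vec s"
      and meas: "\<forall>i<s. (\<lambda>\<omega>. X \<omega> $ i) \<in> borel_measurable P"
  proof -
    have "integrable P (\<lambda>\<omega>. X \<omega> \<bullet> X \<omega>) \<longleftrightarrow> integrable P (\<lambda>\<omega>. \<Sum>i<s. (X \<omega> $ i)\<^sup>2)"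
      by (intro Bochner_Integration.integrable_cong refl)
        (use car in \<open>auto simp: scalar_prod_def power2_eq_square atLeast0LessThan\<close>)
    also have "\<dots> \<longleftrightarrow> (\<forall>i<s. integrable P (\<lambda>\<omega>. (X \<omega> $ i)\<^sup>2))"
    proof safe
      fix i assume int: "integrable P (\<lambda>\<omega>. \<Sum>i<s. (X \<omega> $ i)\<^sup>2)" and i: "i < s"
      show "integrable P (\<lambda>\<omega>. (X \<omega> $ i)\<^sup>2)"
      proof (rule Bochner_Integration.integrable_bound[OF int])
        show "(\<lambda>\<omega>. (X \<omega> $ i)\<^sup>2) \<in> borel_measurable P"
          using meas i by auto
        have "(X \<omega> $ i)\<^sup>2 \<le> (\<Sum>i<s. (X \<omega> $ i)\<^sup>2)" for \<omega>
          by (rule member_le_sum[where f = "\<lambda>i. (X \<omega> $ i)\<^sup>2"]) (use i in auto)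
        then show "AE \<omega> in P. norm ((X \<omega> $ i)\<^sup>2) \<le> norm (\<Sum>i<s. (X \<omega> $ i)\<^sup>2)"
          by (auto simp: abs_of_nonneg sum_nonneg)
      qed
    qed auto
    finally show ?thesis .
  qed
  moreover have "(\<lambda>\<omega>. X \<omega> $ i) \<in> borel_measurable P"
    if "vec_measurable (past P w k) s X" "i < s" for i
    using that measurable_past[of "\<lambda>\<omega>. X \<omega> $ i" k] by (simp add: vec_measurable_def)
  ultimately show ?thesis
    unfolding L2F_def L2_def past_L2_def vec_measurable_def space_past by blast
qed

lemma L2F_carrier: "X \<in> L2F k s \<Longrightarrow> \<omega> \<in> space P \<Longrightarrow> X \<omega> \<in> carrier_vec s"
  by (simp add: L2F_iff)

lemma L2F_dim: "X \<in> L2F k s \<Longrightarrow> \<omega> \<in> space P \<Longrightarrow> dim_vec (X \<omega>) = s"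
  by (auto simp: L2F_iff)

lemma L2F_const: "v \<in> carrier_vec s \<Longrightarrow> (\<lambda>_. v) \<in> L2F k s"
  by (simp add: L2F_iff past_L2_const)

lemma L2F_add:
  assumes "X \<in> L2F k s" "Y \<in> L2F k s"
  shows "(\<lambda>\<omega>. X \<omega> + Y \<omega>) \<in> L2F k s"
proof -
  have "past_L2 k (\<lambda>\<omega>. (X \<omega> + Y \<omega>) $ i)" if "i < s" for i
  proof -
    have "past_L2 k (\<lambda>\<omega>. X \<omega> $ i + Y \<omega> $ i)"
      using assms that by (intro past_L2_add) (auto simp: L2F_iff)
    \<comment> \<open>The coordinate formula is available only on \<open>space P\<close>, where the
      dimensions are known, so it is transported by congruence there.\<close>
    then show ?thesis
      by (rule past_L2_cong[THEN iffD1, rotated]) (use that L2F_dim[OF assms(2)] in auto)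
  qed
  then show ?thesis using assms by (auto simp: L2F_iff)
qed

lemma L2F_mult:
  assumes X: "X \<in> L2F k s" and T: "T \<in> carrier_mat r s"
  shows "(\<lambda>\<omega>. T *\<^sub>v X \<omega>) \<in> L2F k r"
proof -
  have "past_L2 k (\<lambda>\<omega>. (T *\<^sub>v X \<omega>) $ i)" if i: "i < r" for i
  proof -
    have "past_L2 k (\<lambda>\<omega>. \<Sum>j<s. T $$ (i, j) * X \<omega> $ j)"
      using X by (intro past_L2_sum past_L2_cmult) (auto simp: L2F_iff)
    then show ?thesis
      by (rule past_L2_cong[THEN iffD1, rotated])
        (use T i L2F_dim[OF X] in \<open>auto simp: scalar_prod_def atLeast0LessThan\<close>)
  qed
  then show ?thesis using X T by (auto simp: L2F_iff)
qed

lemma L2F_diff: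
  assumes X: "X \<in> L2F k s" and Y: "Y \<in> L2F k s"
  shows "(\<lambda>\<omega>. X \<omega> - Y \<omega>) \<in> L2F k s"
proof -
  have "past_L2 k (\<lambda>\<omega>. (X \<omega> - Y \<omega>) $ i)" if "i < s" for i
  proof -
    have "past_L2 k (\<lambda>\<omega>. X \<omega> $ i + (- 1) * Y \<omega> $ i)"
      using assms that by (intro past_L2_add past_L2_cmult) (auto simp: L2F_iff)
    then show ?thesis
      by (rule past_L2_cong[THEN iffD1, rotated]) (use that L2F_dim[OF Y] in auto)
  qed
  then show ?thesis using assms by (auto simp: L2F_iff)
qed

lemma L2F_append:
  assumes X: "X \<in> L2F k s" and Y: "Y \<in> L2F k r"
  shows "(\<lambda>\<omega>. X \<omega> @\<^sub>v Y \<omega>) \<in> L2F k (s + r)"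
proof -
  have "past_L2 k (\<lambda>\<omega>. (X \<omega> @\<^sub>v Y \<omega>) $ i)" if "i < s + r" for i
  proof -
    have "past_L2 k (\<lambda>\<omega>. if i < s then X \<omega> $ i else Y \<omega> $ (i - s))"
      using assms that by (cases "i < s") (auto simp: L2F_iff)
    then show ?thesis
      by (rule past_L2_cong[THEN iffD1, rotated]) (use that L2F_dim[OF X] L2F_dim[OF Y] in auto)
  qed
  then show ?thesis using assms by (auto simp: L2F_iff)
qed

lemma L2F_step:
  assumes X: "X \<in> L2F k s" and Y: "Y \<in> L2F k s"
  shows "(\<lambda>\<omega>. X \<omega> + w k \<omega> \<cdot>\<^sub>v Y \<omega>) \<in> L2F (Suc k) s"
proof -
  have "past_L2 (Suc k) (\<lambda>\<omega>. (X \<omega> + w k \<omega> \<cdot>\<^sub>v Y \<omega>) $ i)" if "i < s" for i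
  proof -
    have "past_L2 (Suc k) (\<lambda>\<omega>. X \<omega> $ i + w k \<omega> * Y \<omega> $ i)"
      using assms that by (intro past_L2_step) (auto simp: L2F_iff)
    then show ?thesis
      by (rule past_L2_cong[THEN iffD1, rotated]) (use that L2F_dim[OF Y] in auto)
  qed
  then show ?thesis using assms by (auto simp: L2F_iff)
qed

lemma L2F_scalar_prod:
  assumes X: "X \<in> L2F k s" and Y: "Y \<in> L2F k s"
  shows "(\<lambda>\<omega>. X \<omega> \<bullet> Y \<omega>) \<in> borel_measurable (past P w k)"
    and "integrable P (\<lambda>\<omega>. X \<omega> \<bullet> Y \<omega>)"
proof -
  have eq: "X \<omega> \<bullet> Y \<omega> = (\<Sum>i<s. X \<omega> $ i * Y \<omega> $ i)" if "\<omega> \<in> space P" for \<omega>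
    unfolding scalar_prod_def L2F_dim[OF Y that] atLeast0LessThan ..
  have L2: "past_L2 k (\<lambda>\<omega>. X \<omega> $ i)" "past_L2 k (\<lambda>\<omega>. Y \<omega> $ i)" if "i < s" for i
    using assms that by (simp_all add: L2F_iff)
  have "(\<lambda>\<omega>. \<Sum>i<s. X \<omega> $ i * Y \<omega> $ i) \<in> borel_measurable (past P w k)"
  proof (rule borel_measurable_sum)
    fix i assume "i \<in> {..<s}"
    then have "(\<lambda>\<omega>. X \<omega> $ i) \<in> borel_measurable (past P w k)"
      "(\<lambda>\<omega>. Y \<omega> $ i) \<in> borel_measurable (past P w k)"
      using L2[of i] by (simp_all add: past_L2_def)
    then show "(\<lambda>\<omega>. X \<omega> $ i * Y \<omega> $ i) \<in> borel_measurable (past P w k)"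
      by (rule borel_measurable_times)
  qed
  moreover have "(\<lambda>\<omega>. X \<omega> \<bullet> Y \<omega>) \<in> borel_measurable (past P w k) \<longleftrightarrow>
    (\<lambda>\<omega>. \<Sum>i<s. X \<omega> $ i * Y \<omega> $ i) \<in> borel_measurable (past P w k)"
    by (rule measurable_cong) (simp add: eq)
  ultimately show "(\<lambda>\<omega>. X \<omega> \<bullet> Y \<omega>) \<in> borel_measurable (past P w k)"
    by (simp only:)
  have "integrable P (\<lambda>\<omega>. \<Sum>i<s. X \<omega> $ i * Y \<omega> $ i)"
    by (rule Bochner_Integration.integrable_sum, rule past_L2_mult_integrable) (use L2 in simp_all)
  moreover have "integrable P (\<lambda>\<omega>. X \<omega> \<bullet> Y \<omega>) \<longleftrightarrow> integrable P (\<lambda>\<omega>. \<Sum>i<s. X \<omega> $ i * Y \<omega> $ i)"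
    by (rule Bochner_Integration.integrable_cong[OF refl]) (rule eq)
  ultimately show "integrable P (\<lambda>\<omega>. X \<omega> \<bullet> Y \<omega>)"
    by (simp only:)
qed

text \<open>Both noise factors average out: the noise has mean zero and unit variance and is independent of
  its past.\<close>
lemma expectation_step_scalar_prod:
  assumes L2F: "X \<in> L2F k s" "X' \<in> L2F k s" "Y \<in> L2F k s" "Y' \<in> L2F k s"
  shows "expectation (\<lambda>\<omega>. (X \<omega> + w k \<omega> \<cdot>\<^sub>v X' \<omega>) \<bullet> (Y \<omega> + w k \<omega> \<cdot>\<^sub>v Y' \<omega>)) =
    expectation (\<lambda>\<omega>. X \<omega> \<bullet> Y \<omega> + X' \<omega> \<bullet> Y' \<omega>)"
proof -
  note sp = L2F_scalar_prod
  let ?m = "\<lambda>\<omega>. X \<omega> \<bullet> Y' \<omega> + X' \<omega> \<bullet> Y \<omega>"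
  have m: "?m \<in> borel_measurable (past P w k)" "integrable P ?m"
    using sp[OF L2F(1,4)] sp[OF L2F(2,3)] by auto
  have "expectation (\<lambda>\<omega>. (X \<omega> + w k \<omega> \<cdot>\<^sub>v X' \<omega>) \<bullet> (Y \<omega> + w k \<omega> \<cdot>\<^sub>v Y' \<omega>)) =
    expectation (\<lambda>\<omega>. X \<omega> \<bullet> Y \<omega> + (w k \<omega> * ?m \<omega> + (w k \<omega>)\<^sup>2 * (X' \<omega> \<bullet> Y' \<omega>)))"
  proof (intro Bochner_Integration.integral_cong refl)
    fix \<omega> assume "\<omega> \<in> space P"
    then have c: "X \<omega> \<in> carrier_vec s" "X' \<omega> \<in> carrier_vec s" "Y \<omega> \<in> carrier_vec s" "Y' \<omega> \<in> carrier_vec s"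
      using L2F L2F_carrier by blast+
    have right: "v \<bullet> (Y \<omega> + w k \<omega> \<cdot>\<^sub>v Y' \<omega>) = v \<bullet> Y \<omega> + w k \<omega> * (v \<bullet> Y' \<omega>)"
      if "v \<in> carrier_vec s" for v
      using c that by (subst scalar_prod_add_distrib[of _ s]) auto
    have "(X \<omega> + w k \<omega> \<cdot>\<^sub>v X' \<omega>) \<bullet> (Y \<omega> + w k \<omega> \<cdot>\<^sub>v Y' \<omega>) =
      X \<omega> \<bullet> (Y \<omega> + w k \<omega> \<cdot>\<^sub>v Y' \<omega>) + (w k \<omega> \<cdot>\<^sub>v X' \<omega>) \<bullet> (Y \<omega> + w k \<omega> \<cdot>\<^sub>v Y' \<omega>)"
      by (rule add_scalar_prod_distrib[of _ s]) (use c in auto)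
    also have "(w k \<omega> \<cdot>\<^sub>v X' \<omega>) \<bullet> (Y \<omega> + w k \<omega> \<cdot>\<^sub>v Y' \<omega>) = w k \<omega> * (X' \<omega> \<bullet> (Y \<omega> + w k \<omega> \<cdot>\<^sub>v Y' \<omega>))"
      by (rule smult_scalar_prod_distrib[of _ s]) (use c in auto)
    also note right[OF c(1)]
    also note right[OF c(2)]
    finally show "(X \<omega> + w k \<omega> \<cdot>\<^sub>v X' \<omega>) \<bullet> (Y \<omega> + w k \<omega> \<cdot>\<^sub>v Y' \<omega>) =
      X \<omega> \<bullet> Y \<omega> + (w k \<omega> * ?m \<omega> + (w k \<omega>)\<^sup>2 * (X' \<omega> \<bullet> Y' \<omega>))"
      by (simp add: power2_eq_square distrib_left mult.assoc add.assoc)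
  qed
  also have "\<dots> = expectation (\<lambda>\<omega>. X \<omega> \<bullet> Y \<omega>) + expectation (\<lambda>\<omega>. X' \<omega> \<bullet> Y' \<omega>)"
    using expectation_noise_mult[OF m] expectation_noise_square_mult[OF sp[OF L2F(2,4)]]
      sp(2)[OF L2F(1,3)]
    by simp
  also have "\<dots> = expectation (\<lambda>\<omega>. X \<omega> \<bullet> Y \<omega> + X' \<omega> \<bullet> Y' \<omega>)"
    using sp(2)[OF L2F(1,3)] sp(2)[OF L2F(2,4)] by simp
  finally show ?thesis .
qed

end

section \<open>The adjoint process and the Gramian as an expectation\<close>

lemma mult_mat_unit_vec:
  fixes X :: rmat
  assumes "X \<in> carrier_mat r s" "i < s"
  shows "X *\<^sub>v unit_vec s i = col X i"
  using assms by (intro eq_vecI) auto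

locale stochastic_gramian = noise_space P w + gramian_system n q C Cbar D
  for P :: "'a measure" and w n q C Cbar D
begin

text \<open>This is \<open>p(k)\<close>, run forward in time: transposition reverses the product
  \<open>C(0) \<cdots> C(k-1)\<close>, so the newest factor acts last.\<close>

primrec adj :: "rvec \<Rightarrow> nat \<Rightarrow> 'a \<Rightarrow> rvec" where
  "adj a 0 \<omega> = a"
| "adj a (Suc k) \<omega> = C\<^sup>T *\<^sub>v adj a k \<omega> + w k \<omega> \<cdot>\<^sub>v (Cbar\<^sup>T *\<^sub>v adj a k \<omega>)"

lemma adj_carrier [simp]: "a \<in> carrier_vec n \<Longrightarrow> adj a k \<omega> \<in> carrier_vec n"
  by (induction k) auto

lemma adj_L2F: "a \<in> carrier_vec n \<Longrightarrow> adj a k \<in> L2F k n"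
proof (induction k)
  case 0
  have "adj a 0 = (\<lambda>_. a)" by auto
  then show ?case using L2F_const[of a n 0] 0 by simp
next
  case (Suc k)
  have "adj a (Suc k) = (\<lambda>\<omega>. C\<^sup>T *\<^sub>v adj a k \<omega> + w k \<omega> \<cdot>\<^sub>v (Cbar\<^sup>T *\<^sub>v adj a k \<omega>))" by auto
  moreover have "\<dots> \<in> L2F (Suc k) n"
    using Suc by (intro L2F_step L2F_mult[of _ _ n]) auto
  ultimately show ?case by simp
qed

lemma Cprod_carrier [simp]: "Cprod n C Cbar w k \<omega> \<in> carrier_mat n n"
  by (induction k) (auto intro!: mult_carrier_mat[of _ n n])

lemma adj_eq_Cprod: "a \<in> carrier_vec n \<Longrightarrow> adj a k \<omega> = (Cprod n C Cbar w k \<omega>)\<^sup>T *\<^sub>v a"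
proof (induction k)
  case (Suc k)
  let ?p = "(Cprod n C Cbar w k \<omega>)\<^sup>T *\<^sub>v a"
  have p: "?p \<in> carrier_vec n" using Suc.prems by (intro mult_mat_vec_carrier[of _ n n]) auto
  have "(Cprod n C Cbar w (Suc k) \<omega>)\<^sup>T *\<^sub>v a = (C + w k \<omega> \<cdot>\<^sub>m Cbar)\<^sup>T *\<^sub>v ?p"
    using Suc.prems by (simp add: transpose_mult_mult_vec[of _ _ n])
  also have "(C + w k \<omega> \<cdot>\<^sub>m Cbar)\<^sup>T = C\<^sup>T + w k \<omega> \<cdot>\<^sub>m Cbar\<^sup>T"
    using carrier_matD[OF C_carrier] carrier_matD[OF Cbar_carrier] by (intro eq_matI) auto
  also have "\<dots> *\<^sub>v ?p = C\<^sup>T *\<^sub>v ?p + (w k \<omega> \<cdot>\<^sub>m Cbar\<^sup>T) *\<^sub>v ?p"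
    using p by (intro add_mult_distrib_mat_vec[of _ n n]) auto
  also have "(w k \<omega> \<cdot>\<^sub>m Cbar\<^sup>T) *\<^sub>v ?p = w k \<omega> \<cdot>\<^sub>v (Cbar\<^sup>T *\<^sub>v ?p)"
    using carrier_vecD[OF p] carrier_matD[OF Cbar_carrier] carrier_matD[OF Cprod_carrier[of k \<omega>]]
    by (intro eq_vecI) auto
  finally show ?case using Suc by simp
qed simp

text \<open>Each step splits off one \<open>D\<close> term and moves the form with
  \<open>gram j\<close> from time \<open>k\<close> to \<open>Suc k\<close>; hence the arbitrary
  starting time in the induction.\<close>

lemma expectation_gram:
  assumes a: "a \<in> carrier_vec n" and b: "b \<in> carrier_vec n"
  shows "expectation (\<lambda>\<omega>. adj a k \<omega> \<bullet> (gram j *\<^sub>v adj b k \<omega>)) =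
    (\<Sum>i<j. expectation (\<lambda>\<omega>. (D\<^sup>T *\<^sub>v adj a (k + i) \<omega>) \<bullet> (D\<^sup>T *\<^sub>v adj b (k + i) \<omega>)))"
proof (induction j arbitrary: k)
  case 0
  have "adj a k \<omega> \<bullet> (gram 0 *\<^sub>v adj b k \<omega>) = 0" for \<omega>
    using a b by (simp add: zero_mat_mult_vec)
  then show ?case by simp
next
  case (Suc j)
  let ?CX = "\<lambda>\<omega>. C\<^sup>T *\<^sub>v adj a k \<omega>" and ?BX = "\<lambda>\<omega>. Cbar\<^sup>T *\<^sub>v adj a k \<omega>"
  let ?CY = "\<lambda>\<omega>. gram j *\<^sub>v (C\<^sup>T *\<^sub>v adj b k \<omega>)" and ?BY = "\<lambda>\<omega>. gram j *\<^sub>v (Cbar\<^sup>T *\<^sub>v adj b k \<omega>)"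
  have L2F: "?CX \<in> L2F k n" "?BX \<in> L2F k n" "?CY \<in> L2F k n" "?BY \<in> L2F k n"
    "(\<lambda>\<omega>. D\<^sup>T *\<^sub>v adj a k \<omega>) \<in> L2F k q" "(\<lambda>\<omega>. D\<^sup>T *\<^sub>v adj b k \<omega>) \<in> L2F k q"
    using a b by (auto intro!: L2F_mult[of _ _ n] adj_L2F)
  have "expectation (\<lambda>\<omega>. adj a k \<omega> \<bullet> (gram (Suc j) *\<^sub>v adj b k \<omega>)) =
    expectation (\<lambda>\<omega>. (?CX \<omega> \<bullet> ?CY \<omega> + ?BX \<omega> \<bullet> ?BY \<omega>) + (D\<^sup>T *\<^sub>v adj a k \<omega>) \<bullet> (D\<^sup>T *\<^sub>v adj b k \<omega>))"
    using a b by (simp only: gram_quadratic_form adj_carrier)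
  also have "\<dots> = expectation (\<lambda>\<omega>. ?CX \<omega> \<bullet> ?CY \<omega> + ?BX \<omega> \<bullet> ?BY \<omega>) +
    expectation (\<lambda>\<omega>. (D\<^sup>T *\<^sub>v adj a k \<omega>) \<bullet> (D\<^sup>T *\<^sub>v adj b k \<omega>))"
    by (intro Bochner_Integration.integral_add Bochner_Integration.integrable_add
        L2F_scalar_prod(2)[OF L2F(1,3)] L2F_scalar_prod(2)[OF L2F(2,4)] L2F_scalar_prod(2)[OF L2F(5,6)])
  \<comment> \<open>Read from right to left, the averaging identity reassembles the \<open>C\<close>
    and \<open>Cbar\<close> terms into the adjoint vectors at time \<open>Suc k\<close>.\<close>
  also have "expectation (\<lambda>\<omega>. ?CX \<omega> \<bullet> ?CY \<omega> + ?BX \<omega> \<bullet> ?BY \<omega>) =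
    expectation (\<lambda>\<omega>. (?CX \<omega> + w k \<omega> \<cdot>\<^sub>v ?BX \<omega>) \<bullet> (?CY \<omega> + w k \<omega> \<cdot>\<^sub>v ?BY \<omega>))"
    by (rule expectation_step_scalar_prod[OF L2F(1-4), symmetric])
  also have "\<dots> = expectation (\<lambda>\<omega>. adj a (Suc k) \<omega> \<bullet> (gram j *\<^sub>v adj b (Suc k) \<omega>))"
    using b by (simp add: mult_add_distrib_mat_vec[OF gram_carrier] mult_mat_vec[OF gram_carrier])
  also have "\<dots> = (\<Sum>i<j. expectation (\<lambda>\<omega>. (D\<^sup>T *\<^sub>v adj a (Suc k + i) \<omega>) \<bullet> (D\<^sup>T *\<^sub>v adj b (Suc k + i) \<omega>)))"
    by (rule Suc.IH)
  finally show ?case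
    by (simp add: sum.lessThan_Suc_shift add.commute del: sum.lessThan_Suc gram.simps adj.simps)
qed

text \<open>Entries are values of the bilinear form at unit vectors, and
  \<open>expectation_gram\<close> is applied at time 0, where \<open>adj\<close> is
  deterministic.\<close>

lemma gramian_eq_gram: "gramian P w n C Cbar D N = gram (Suc N)"
proof (rule eq_matI)
  fix r s assume "r < dim_row (gram (Suc N))" "s < dim_col (gram (Suc N))"
  then have rs: "r < n" "s < n" using gram_carrier[of "Suc N"] by auto
  let ?a = "unit_vec n r :: rvec" and ?b = "unit_vec n s :: rvec"
  \<comment> \<open>Both sides are the scalar product of rows \<open>r\<close> and \<open>s\<close>
    of \<open>Cprod n C Cbar w i \<omega> * D\<close>.\<close>
  have entry: "(Cprod n C Cbar w i \<omega> * D * D\<^sup>T * (Cprod n C Cbar w i \<omega>)\<^sup>T) $$ (r, s) =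
    (D\<^sup>T *\<^sub>v adj ?a i \<omega>) \<bullet> (D\<^sup>T *\<^sub>v adj ?b i \<omega>)" for i \<omega>
  proof -
    let ?W = "Cprod n C Cbar w i \<omega>"
    have WD: "?W * D \<in> carrier_mat n q" by (rule mult_carrier_mat[of _ n n]) auto
    have adj: "D\<^sup>T *\<^sub>v adj (unit_vec n t) i \<omega> = row (?W * D) t" if "t < n" for t
    proof -
      have "D\<^sup>T *\<^sub>v adj (unit_vec n t) i \<omega> = (?W * D)\<^sup>T *\<^sub>v unit_vec n t"
        by (simp add: adj_eq_Cprod transpose_mult_mult_vec[of _ D q])
      also have "\<dots> = row (?W * D) t"
        using that WD by (subst mult_mat_unit_vec[of _ q n]) auto
      finally show ?thesis .
    qed
    have "?W * D * D\<^sup>T * ?W\<^sup>T = ?W * D * (D\<^sup>T * ?W\<^sup>T)"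
      by (rule assoc_mult_mat[OF WD transpose_carriers(3), of _ n]) simp
    also have "D\<^sup>T * ?W\<^sup>T = (?W * D)\<^sup>T"
      by (rule transpose_mult[OF Cprod_carrier D_carrier, symmetric])
    finally have "?W * D * D\<^sup>T * ?W\<^sup>T = (?W * D) * (?W * D)\<^sup>T" .
    then show ?thesis
      using adj rs carrier_matD[OF Cprod_carrier[of i \<omega>]] by simp
  qed
  have "gram (Suc N) $$ (r, s) = ?a \<bullet> (gram (Suc N) *\<^sub>v ?b)"
    using rs mult_mat_unit_vec[OF gram_carrier rs(2), of "Suc N"] gram_carrier[of "Suc N"]
    by (simp del: gram.simps gram_carrier)
  also have "\<dots> = expectation (\<lambda>\<omega>. adj ?a 0 \<omega> \<bullet> (gram (Suc N) *\<^sub>v adj ?b 0 \<omega>))"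
    unfolding adj.simps(1) by (simp add: prob_space del: gram.simps)
  also have "\<dots> = (\<Sum>i<Suc N. expectation (\<lambda>\<omega>. (D\<^sup>T *\<^sub>v adj ?a (0 + i) \<omega>) \<bullet> (D\<^sup>T *\<^sub>v adj ?b (0 + i) \<omega>)))"
    by (rule expectation_gram) auto
  also have "\<dots> = gramian P w n C Cbar D N $$ (r, s)"
    unfolding gramian_def mat_expectation_def using rs
    by (simp only: index_mat fst_conv snd_conv prod.case entry atLeast0AtMost lessThan_Suc_atMost add_0)
  finally show "gramian P w n C Cbar D N $$ (r, s) = gram (Suc N) $$ (r, s)" ..
qed (use gram_carrier[of "Suc N"] in \<open>auto simp: gramian_def\<close>)

text \<open>Each adjoint step costs one unit of horizon, so unobservability at all horizons is
  preserved outcome by outcome.\<close>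

lemma unobservable_adj:
  assumes a: "a \<in> carrier_vec n" and un: "\<And>j. unobservable j a"
  shows "unobservable j (adj a k \<omega>)"
proof (induction k arbitrary: j)
  case (Suc k)
  have "unobservable j (C\<^sup>T *\<^sub>v adj a k \<omega>)" "unobservable j (Cbar\<^sup>T *\<^sub>v adj a k \<omega>)"
    using Suc.IH[of "Suc j"] by auto
  then show ?case using a by (auto intro!: unobservable_add unobservable_smult)
qed (use un in simp)

end

section \<open>The controlled system\<close>

lemma append_cols_mult_vec:
  assumes X: "X \<in> carrier_mat r s" and Y: "Y \<in> carrier_mat r t"
    and a: "a \<in> carrier_vec s" and b: "b \<in> carrier_vec t"
  shows "append_cols X Y *\<^sub>v (a @\<^sub>v b) = X *\<^sub>v a + Y *\<^sub>v b"
proof (rule eq_vecI)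
  fix i assume "i < dim_vec (X *\<^sub>v a + Y *\<^sub>v b)"
  then have i: "i < r" using Y by simp
  have "row (append_cols X Y) i = row X i @\<^sub>v row Y i"
    unfolding append_cols_def using X Y i by (intro row_four_block_mat) auto
  moreover have "(row X i @\<^sub>v row Y i) \<bullet> (a @\<^sub>v b) = row X i \<bullet> a + row Y i \<bullet> b"
    using X Y a b by (intro scalar_prod_append) auto
  ultimately show "(append_cols X Y *\<^sub>v (a @\<^sub>v b)) $ i = (X *\<^sub>v a + Y *\<^sub>v b) $ i"
    using X Y i by (simp add: append_cols_def)
qed (use X Y in \<open>simp add: append_cols_def\<close>)

text \<open>Guarantees that \<open>mat_inverse\<close> returns a value for an invertible matrix, so
  that \<open>the (mat_inverse X)\<close> is a genuine two-sided inverse.\<close>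

lemma invertible_mat_inverseE:
  assumes "X \<in> carrier_mat r r" "invertible_mat (X :: rmat)"
  obtains Y where "Y \<in> carrier_mat r r" "X * Y = 1\<^sub>m r" "Y * X = 1\<^sub>m r" "mat_inverse X = Some Y"
proof -
  obtain Z where Z: "X * Z = 1\<^sub>m r" "Z * X = 1\<^sub>m (dim_row Z)"
    using assms by (auto simp: invertible_mat_def inverts_mat_def)
  then have Zc: "Z \<in> carrier_mat r r"
    using assms by (metis carrier_matD(2) carrier_mat_triv index_mult_mat(2,3) index_one_mat(3))
  then have "X \<in> Units (ring_mat TYPE(real) r ())"
    using assms(1) Z by (auto simp: Units_def ring_mat_simps)
  then obtain Y where "mat_inverse X = Some Y"
    using mat_inverse(1)[OF assms(1), of "()"] by blast
  with mat_inverse(2)[OF assms(1) this] that show thesis by blast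
qed

section \<open>Change of input variables and inversion of the dynamics\<close>

locale control_system = noise_space P w
  for P :: "'a measure" and w :: "nat \<Rightarrow> 'a \<Rightarrow> real" +
  fixes n m :: nat and A Abar B Bbar M L F C Cbar D :: rmat
  assumes A_carrier: "A \<in> carrier_mat n n" and Abar_carrier: "Abar \<in> carrier_mat n n"
    and B_carrier: "B \<in> carrier_mat n m" and Bbar_carrier: "Bbar \<in> carrier_mat n m"
    and M_carrier: "M \<in> carrier_mat m m" and M_invertible: "invertible_mat M"
    and Bbar_M: "Bbar * M = append_cols (1\<^sub>m n) (0\<^sub>m n (m - n))"
    and L_carrier: "L \<in> carrier_mat n n" and F_carrier: "F \<in> carrier_mat n (m - n)"
    and B_M: "B * M = append_cols L F"
    and K_invertible: "invertible_mat (A - L * Abar)"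
    and C_eq: "C = the (mat_inverse (A - L * Abar))"
    and Cbar_eq: "Cbar = - (C * L)"
    and D_eq: "D = - (C * F)"
begin

abbreviation K :: rmat where "K \<equiv> A - L * Abar"

lemma K_carrier: "K \<in> carrier_mat n n"
  using A_carrier L_carrier Abar_carrier by (intro minus_carrier_mat mult_carrier_mat)

lemma C_inverse: "C \<in> carrier_mat n n" "K * C = 1\<^sub>m n" "C * K = 1\<^sub>m n"
proof -
  obtain Y where "Y \<in> carrier_mat n n" "K * Y = 1\<^sub>m n" "Y * K = 1\<^sub>m n" "mat_inverse K = Some Y"
    using K_carrier K_invertible by (rule invertible_mat_inverseE)
  then show "C \<in> carrier_mat n n" "K * C = 1\<^sub>m n" "C * K = 1\<^sub>m n"
    unfolding C_eq by auto
qed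

text \<open>Subtraction on naturals truncates; comparing the numbers of columns in
  \<open>Bbar_M\<close> shows that here it does not.\<close>

lemma m_eq: "m = n + (m - n)"
proof -
  have "dim_col (Bbar * M) = n + (m - n)" unfolding Bbar_M by (simp add: append_cols_def)
  then show ?thesis using M_carrier by simp
qed

sublocale stochastic_gramian P w n "m - n" C Cbar D
proof unfold_locales
  show "C \<in> carrier_mat n n" by (rule C_inverse)
  show "Cbar \<in> carrier_mat n n"
    unfolding Cbar_eq using C_inverse(1) L_carrier by (intro uminus_carrier_mat mult_carrier_mat)
  show "D \<in> carrier_mat n (m - n)"
    unfolding D_eq using C_inverse(1) F_carrier by (intro uminus_carrier_mat mult_carrier_mat)
qed

lemma system_carriers [simp]:
  "v \<in> carrier_vec n \<Longrightarrow> A *\<^sub>v v \<in> carrier_vec n" "v \<in> carrier_vec n \<Longrightarrow> Abar *\<^sub>v v \<in> carrier_vec n"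
  "u \<in> carrier_vec m \<Longrightarrow> B *\<^sub>v u \<in> carrier_vec n" "u \<in> carrier_vec m \<Longrightarrow> Bbar *\<^sub>v u \<in> carrier_vec n"
  "u \<in> carrier_vec m \<Longrightarrow> M *\<^sub>v u \<in> carrier_vec m" "v \<in> carrier_vec n \<Longrightarrow> L *\<^sub>v v \<in> carrier_vec n"
  "r \<in> carrier_vec (m - n) \<Longrightarrow> F *\<^sub>v r \<in> carrier_vec n" "v \<in> carrier_vec n \<Longrightarrow> K *\<^sub>v v \<in> carrier_vec n"
  using A_carrier Abar_carrier B_carrier Bbar_carrier M_carrier L_carrier F_carrier K_carrier
  by (auto intro: mult_mat_vec_carrier)

lemma K_mult_vec: "v \<in> carrier_vec n \<Longrightarrow> K *\<^sub>v v = A *\<^sub>v v - L *\<^sub>v (Abar *\<^sub>v v)"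
  using A_carrier Abar_carrier L_carrier
  by (simp add: minus_mult_distrib_mat_vec[of _ n n] assoc_mult_mat_vec[of _ n n _ n])

text \<open>In the coordinates given by \<open>M\<close>, the first block \<open>p\<close>
  prescribes the input part of the noise coefficient, while \<open>r\<close> acts on the drift
  alone, through \<open>F\<close>.\<close>

lemma input_split:
  assumes p: "p \<in> carrier_vec n" and r: "r \<in> carrier_vec (m - n)"
  shows "M *\<^sub>v (p @\<^sub>v r) \<in> carrier_vec m"
    and "Bbar *\<^sub>v (M *\<^sub>v (p @\<^sub>v r)) = p" and "B *\<^sub>v (M *\<^sub>v (p @\<^sub>v r)) = L *\<^sub>v p + F *\<^sub>v r"
proof -
  have pr: "p @\<^sub>v r \<in> carrier_vec m"
    using append_carrier_vec[OF p r] m_eq by simp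
  then show "M *\<^sub>v (p @\<^sub>v r) \<in> carrier_vec m" by simp
  have "Bbar *\<^sub>v (M *\<^sub>v (p @\<^sub>v r)) = (Bbar * M) *\<^sub>v (p @\<^sub>v r)"
    by (rule assoc_mult_mat_vec[OF Bbar_carrier M_carrier pr, symmetric])
  also have "\<dots> = p"
    unfolding Bbar_M using p r by (simp add: append_cols_mult_vec[of _ n n _ "m - n"] zero_mat_mult_vec)
  finally show "Bbar *\<^sub>v (M *\<^sub>v (p @\<^sub>v r)) = p" .
  have "B *\<^sub>v (M *\<^sub>v (p @\<^sub>v r)) = (B * M) *\<^sub>v (p @\<^sub>v r)"
    by (rule assoc_mult_mat_vec[OF B_carrier M_carrier pr, symmetric])
  also have "\<dots> = L *\<^sub>v p + F *\<^sub>v r"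
    unfolding B_M by (rule append_cols_mult_vec[OF L_carrier F_carrier p r])
  finally show "B *\<^sub>v (M *\<^sub>v (p @\<^sub>v r)) = L *\<^sub>v p + F *\<^sub>v r" .
qed

lemma input_split_ex:
  assumes u: "u \<in> carrier_vec m"
  obtains r where "r \<in> carrier_vec (m - n)" "B *\<^sub>v u = L *\<^sub>v (Bbar *\<^sub>v u) + F *\<^sub>v r"
proof -
  obtain Y where Y: "Y \<in> carrier_mat m m" "M * Y = 1\<^sub>m m"
    using invertible_mat_inverseE[OF M_carrier M_invertible] by metis
  define p r where "p = vec_first (Y *\<^sub>v u) n" and "r = vec_last (Y *\<^sub>v u) (m - n)"
  have c: "p \<in> carrier_vec n" "r \<in> carrier_vec (m - n)" by (auto simp: p_def r_def)
  have "Y *\<^sub>v u \<in> carrier_vec (n + (m - n))" using Y u m_eq by (metis mult_mat_vec_carrier)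
  then have "p @\<^sub>v r = Y *\<^sub>v u" unfolding p_def r_def by (rule vec_first_last_append)
  then have "M *\<^sub>v (p @\<^sub>v r) = (M * Y) *\<^sub>v u"
    using assoc_mult_mat_vec[OF M_carrier Y(1) u] by simp
  also have "\<dots> = u" using Y u by simp
  finally have "M *\<^sub>v (p @\<^sub>v r) = u" .
  with input_split[OF c] that c show thesis by simp
qed

text \<open>With \<open>z\<close> the noise coefficient, the drift equals
  \<open>K x + L z + F r\<close>; multiplying by \<open>C\<close>, the inverse of \<open>K\<close>,
  gives the backward form.\<close>

lemma C_mult_drift:
  assumes x: "x \<in> carrier_vec n" and u: "u \<in> carrier_vec m"
  obtains r where "r \<in> carrier_vec (m - n)"
    "C *\<^sub>v (A *\<^sub>v x + B *\<^sub>v u) = x - Cbar *\<^sub>v (Abar *\<^sub>v x + Bbar *\<^sub>v u) - D *\<^sub>v r"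
proof -
  obtain r where r: "r \<in> carrier_vec (m - n)" and Bu: "B *\<^sub>v u = L *\<^sub>v (Bbar *\<^sub>v u) + F *\<^sub>v r"
    using input_split_ex[OF u] .
  let ?z = "Abar *\<^sub>v x + Bbar *\<^sub>v u"
  have z: "?z \<in> carrier_vec n" using x u by simp
  have "L *\<^sub>v ?z = L *\<^sub>v (Abar *\<^sub>v x) + L *\<^sub>v (Bbar *\<^sub>v u)"
    using x u by (intro mult_add_distrib_mat_vec[OF L_carrier]) auto
  then have "A *\<^sub>v x + B *\<^sub>v u = K *\<^sub>v x + (L *\<^sub>v ?z + F *\<^sub>v r)"
    unfolding Bu K_mult_vec[OF x] using x u r A_carrier L_carrier F_carrier
    by (intro eq_vecI) auto
  moreover have "C *\<^sub>v (K *\<^sub>v x) = x"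
    using assoc_mult_mat_vec[OF C_carrier K_carrier x] C_inverse(3) x by simp
  moreover have "Cbar *\<^sub>v ?z = - (C *\<^sub>v (L *\<^sub>v ?z))"
    unfolding Cbar_eq using assoc_mult_mat_vec[OF C_carrier L_carrier z] carrier_vecD[OF z] L_carrier
    by (subst uminus_mult_mat_vec) simp_all
  moreover have "D *\<^sub>v r = - (C *\<^sub>v (F *\<^sub>v r))"
    unfolding D_eq using assoc_mult_mat_vec[OF C_carrier F_carrier r] r F_carrier
    by (subst uminus_mult_mat_vec) auto
  ultimately have "C *\<^sub>v (A *\<^sub>v x + B *\<^sub>v u) = x - Cbar *\<^sub>v ?z - D *\<^sub>v r"
    using x z r by (simp add: mult_add_distrib_mat_vec[OF C_carrier])
      (intro eq_vecI, auto)
  with r that show thesis by blast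
qed

text \<open>Converse passage from the backward relation to the controlled system, with
  \<open>t\<close> the realised noise. The first input block \<open>z - Abar x\<close> is chosen so
  that the noise coefficient becomes exactly \<open>z\<close>.\<close>

lemma forward_step:
  assumes c: "x \<in> carrier_vec n" "x' \<in> carrier_vec n" "z \<in> carrier_vec n" "r \<in> carrier_vec (m - n)"
    and bw: "x = C *\<^sub>v x' + Cbar *\<^sub>v z + D *\<^sub>v r - t \<cdot>\<^sub>v (C *\<^sub>v z)"
  defines "u \<equiv> M *\<^sub>v ((z - Abar *\<^sub>v x) @\<^sub>v r)"
  shows "(A *\<^sub>v x + B *\<^sub>v u) + t \<cdot>\<^sub>v (Abar *\<^sub>v x + Bbar *\<^sub>v u) = x'"
proof -
  have p: "z - Abar *\<^sub>v x \<in> carrier_vec n" using c by simp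
  have KC: "K *\<^sub>v (C *\<^sub>v v) = v" if "v \<in> carrier_vec n" for v
    using assoc_mult_mat_vec[OF K_carrier C_carrier that] C_inverse(2) that by simp
  have "Cbar *\<^sub>v z = - (C *\<^sub>v (L *\<^sub>v z))"
    unfolding Cbar_eq using assoc_mult_mat_vec[OF C_carrier L_carrier c(3)] c L_carrier
    by (subst uminus_mult_mat_vec) auto
  moreover have "D *\<^sub>v r = - (C *\<^sub>v (F *\<^sub>v r))"
    unfolding D_eq using assoc_mult_mat_vec[OF C_carrier F_carrier c(4)] c F_carrier
    by (subst uminus_mult_mat_vec) auto
  \<comment> \<open>As \<open>Cbar = - (C * L)\<close> and \<open>D = - (C * F)\<close>, every term
    has the left factor \<open>C\<close>, which \<open>K\<close> then removes.\<close>
  ultimately have "x = C *\<^sub>v (x' - L *\<^sub>v z - F *\<^sub>v r - t \<cdot>\<^sub>v z)"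
    unfolding bw using c
    by (simp add: mult_minus_distrib_mat_vec[OF C_carrier] mult_mat_vec[OF C_carrier])
      (intro eq_vecI, auto)
  then have Kx: "K *\<^sub>v x = x' - L *\<^sub>v z - F *\<^sub>v r - t \<cdot>\<^sub>v z"
    using KC[of "x' - L *\<^sub>v z - F *\<^sub>v r - t \<cdot>\<^sub>v z"] c by simp
  have Bu: "B *\<^sub>v u = (L *\<^sub>v z - L *\<^sub>v (Abar *\<^sub>v x)) + F *\<^sub>v r"
    unfolding u_def input_split(3)[OF p c(4)]
    using c by (simp add: mult_minus_distrib_mat_vec[OF L_carrier])
  have Bbaru: "Abar *\<^sub>v x + Bbar *\<^sub>v u = z"
    unfolding u_def input_split(2)[OF p c(4)]
    using c Abar_carrier by (intro eq_vecI) auto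
  have "(A *\<^sub>v x + B *\<^sub>v u) + t \<cdot>\<^sub>v (Abar *\<^sub>v x + Bbar *\<^sub>v u) =
    K *\<^sub>v x + (L *\<^sub>v z + F *\<^sub>v r + t \<cdot>\<^sub>v z)"
    unfolding Bbaru Bu K_mult_vec[OF c(1)] using c A_carrier L_carrier F_carrier
    by (intro eq_vecI) auto
  also have "\<dots> = x'"
    unfolding Kx using c L_carrier F_carrier by (intro eq_vecI) auto
  finally show ?thesis .
qed

section \<open>Trajectories and the necessity of full rank\<close>

abbreviation trajectory :: "(nat \<Rightarrow> 'a \<Rightarrow> rvec) \<Rightarrow> rvec \<Rightarrow> nat \<Rightarrow> 'a \<Rightarrow> rvec" where
  "trajectory \<equiv> state A Abar B Bbar w"

lemma l2F_iff: "u \<in> l2F P w N s \<longleftrightarrow> (\<forall>k\<le>N. u k \<in> L2F k s)"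
  by (auto simp: l2F_def L2F_def)

lemma trajectory_L2F:
  assumes u: "u \<in> l2F P w N m" and x: "x \<in> carrier_vec n"
  shows "k \<le> Suc N \<Longrightarrow> trajectory u x k \<in> L2F k n"
proof (induction k)
  case 0
  have "trajectory u x 0 = (\<lambda>_. x)" by auto
  then show ?case using L2F_const[OF x] by simp
next
  case (Suc k)
  let ?X = "trajectory u x k"
  have "u k \<in> L2F k m" "?X \<in> L2F k n" using u Suc by (auto simp: l2F_iff)
  then have "(\<lambda>\<omega>. (A *\<^sub>v ?X \<omega> + B *\<^sub>v u k \<omega>) + w k \<omega> \<cdot>\<^sub>v (Abar *\<^sub>v ?X \<omega> + Bbar *\<^sub>v u k \<omega>)) \<in> L2F (Suc k) n"
    by (intro L2F_step L2F_add L2F_mult[OF _ A_carrier] L2F_mult[OF _ B_carrier]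
        L2F_mult[OF _ Abar_carrier] L2F_mult[OF _ Bbar_carrier])
  moreover have "trajectory u x (Suc k) =
      (\<lambda>\<omega>. (A *\<^sub>v ?X \<omega> + B *\<^sub>v u k \<omega>) + w k \<omega> \<cdot>\<^sub>v (Abar *\<^sub>v ?X \<omega> + Bbar *\<^sub>v u k \<omega>))"
    by auto
  ultimately show ?case by simp
qed

text \<open>The control cannot influence the mean of the component of the state along an unobservable
  direction, once that direction is transported by the adjoint dynamics.\<close>
lemma expectation_adj_trajectory:
  assumes u: "u \<in> l2F P w N m" and x: "x \<in> carrier_vec n"
    and a: "a \<in> carrier_vec n" and un: "\<And>j. unobservable j a"
  shows "k \<le> Suc N \<Longrightarrow> expectation (\<lambda>\<omega>. adj a k \<omega> \<bullet> trajectory u x k \<omega>) = a \<bullet> x"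
proof (induction k)
  case 0
  show ?case by (simp add: prob_space)
next
  case (Suc k)
  let ?X = "trajectory u x k" and ?p = "adj a k"
  let ?Y = "\<lambda>\<omega>. A *\<^sub>v ?X \<omega> + B *\<^sub>v u k \<omega>" and ?Z = "\<lambda>\<omega>. Abar *\<^sub>v ?X \<omega> + Bbar *\<^sub>v u k \<omega>"
  have uX: "u k \<in> L2F k m" "?X \<in> L2F k n"
    using u x Suc.prems trajectory_L2F by (auto simp: l2F_iff)
  then have Y: "?Y \<in> L2F k n"
    by (intro L2F_add L2F_mult[OF _ A_carrier] L2F_mult[OF _ B_carrier])
  have Z: "?Z \<in> L2F k n"
    using uX by (intro L2F_add L2F_mult[OF _ Abar_carrier] L2F_mult[OF _ Bbar_carrier])
  have p: "(\<lambda>\<omega>. C\<^sup>T *\<^sub>v ?p \<omega>) \<in> L2F k n" "(\<lambda>\<omega>. Cbar\<^sup>T *\<^sub>v ?p \<omega>) \<in> L2F k n"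
    using a by (auto intro!: L2F_mult[of _ _ n] adj_L2F)
  have "expectation (\<lambda>\<omega>. adj a (Suc k) \<omega> \<bullet> trajectory u x (Suc k) \<omega>) =
    expectation (\<lambda>\<omega>. (C\<^sup>T *\<^sub>v ?p \<omega>) \<bullet> ?Y \<omega> + (Cbar\<^sup>T *\<^sub>v ?p \<omega>) \<bullet> ?Z \<omega>)"
    using expectation_step_scalar_prod[OF p Y Z] by simp
  also have "\<dots> = expectation (\<lambda>\<omega>. ?p \<omega> \<bullet> ?X \<omega>)"
  proof (intro Bochner_Integration.integral_cong refl)
    fix \<omega> assume \<omega>: "\<omega> \<in> space P"
    have c: "?X \<omega> \<in> carrier_vec n" "u k \<omega> \<in> carrier_vec m" "?p \<omega> \<in> carrier_vec n"
      using uX L2F_carrier \<omega> a by auto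
    \<comment> \<open>\<open>r\<close> is taken for the fixed outcome \<omega>; it drops out below
      because unobservability at horizon 1 says
      \<open>D\<^sup>T *\<^sub>v ?p \<omega> = 0\<^sub>v (m - n)\<close>.\<close>
    obtain r where r: "r \<in> carrier_vec (m - n)" and CY: "C *\<^sub>v ?Y \<omega> = ?X \<omega> - Cbar *\<^sub>v ?Z \<omega> - D *\<^sub>v r"
      using C_mult_drift[OF c(1,2)] .
    have "(C\<^sup>T *\<^sub>v ?p \<omega>) \<bullet> ?Y \<omega> = ?p \<omega> \<bullet> (C *\<^sub>v ?Y \<omega>)"
      using c by (intro transpose_vec_mult_scalar[OF C_carrier]) auto
    also have "\<dots> = ?p \<omega> \<bullet> ?X \<omega> - ?p \<omega> \<bullet> (Cbar *\<^sub>v ?Z \<omega>) - ?p \<omega> \<bullet> (D *\<^sub>v r)"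
      unfolding CY using c r by (simp add: scalar_prod_minus_distrib[of _ n])
    also have "?p \<omega> \<bullet> (Cbar *\<^sub>v ?Z \<omega>) = (Cbar\<^sup>T *\<^sub>v ?p \<omega>) \<bullet> ?Z \<omega>"
      using c by (intro transpose_vec_mult_scalar[OF Cbar_carrier, symmetric]) auto
    also have "?p \<omega> \<bullet> (D *\<^sub>v r) = (D\<^sup>T *\<^sub>v ?p \<omega>) \<bullet> r"
      using c r by (intro transpose_vec_mult_scalar[OF D_carrier, symmetric]) auto
    also have "\<dots> = 0"
      using unobservable_adj[OF a un, of 1 k \<omega>] r by simp
    finally show "(C\<^sup>T *\<^sub>v ?p \<omega>) \<bullet> ?Y \<omega> + (Cbar\<^sup>T *\<^sub>v ?p \<omega>) \<bullet> ?Z \<omega> = ?p \<omega> \<bullet> ?X \<omega>" by simp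
  qed
  also have "\<dots> = a \<bullet> x" using Suc by simp
  finally show ?case .
qed

text \<open>The unobservable vector \<open>a\<close> is used twice, as initial state and as start of
  the adjoint process, so that the conserved mean is \<open>a \<bullet> a\<close>.\<close>

lemma null_controllable_imp_full_rank:
  assumes "exactly_null_controllable P w n m A Abar B Bbar"
  shows "vec_space.cols_rank n (R_cols n C Cbar D) = n"
  unfolding cols_rank_iff_orthogonal
proof (intro ballI impI)
  fix a assume a: "a \<in> carrier_vec n" and un: "\<forall>j. unobservable j a"
  show "a = 0\<^sub>v n"
  proof (rule ccontr)
    assume "a \<noteq> 0\<^sub>v n"
    then obtain N u where u: "u \<in> l2F P w N m" and zero: "AE \<omega> in P. trajectory u a (Suc N) \<omega> = 0\<^sub>v n"
      using assms a unfolding exactly_null_controllable_def by blast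
    have "a \<bullet> a = expectation (\<lambda>\<omega>. adj a (Suc N) \<omega> \<bullet> trajectory u a (Suc N) \<omega>)"
      using expectation_adj_trajectory[OF u a a un[rule_format], of "Suc N"]
      by (simp del: adj.simps state.simps)
    also have "\<dots> = 0"
    proof (rule integral_eq_zero_AE)
      show "AE \<omega> in P. adj a (Suc N) \<omega> \<bullet> trajectory u a (Suc N) \<omega> = 0"
        using zero
      proof eventually_elim
        case (elim \<omega>)
        show ?case unfolding elim using adj_carrier[OF a] by (intro scalar_prod_right_zero)
      qed
    qed
    finally show False using \<open>a \<noteq> 0\<^sub>v n\<close> scalar_prod_self_eq_0_iff[OF a] by simp
  qed
qed

text \<open>Zero is an admissible target at every horizon, since the zero pair solves the backward
  equation.\<close>

lemma exactly_controllable_imp_null_controllable: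
  assumes "exactly_controllable P w n m A Abar B Bbar C Cbar"
  shows "exactly_null_controllable P w n m A Abar B Bbar"
  unfolding exactly_null_controllable_def
proof (intro ballI impI)
  fix x :: rvec assume "x \<in> carrier_vec n" "x \<noteq> 0\<^sub>v n"
  then obtain N where N: "N > 0" and ctrl:
    "\<And>\<xi>. \<xi> \<in> solvable_terminals P w n C Cbar N \<Longrightarrow> vec_measurable (past P w (Suc N)) n \<xi> \<Longrightarrow>
       \<exists>u\<in>l2F P w N m. AE \<omega> in P. trajectory u x (Suc N) \<omega> = \<xi> \<omega>"
    using assms unfolding exactly_controllable_def by meson
  have zero: "(\<lambda>_. 0\<^sub>v n) \<in> L2 P n \<and> vec_measurable (past P w k) n (\<lambda>_. 0\<^sub>v n)" for k
    using L2F_const[of "0\<^sub>v n" n k] by (simp add: L2F_def)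
  have "0\<^sub>v n = C *\<^sub>v 0\<^sub>v n + Cbar *\<^sub>v 0\<^sub>v n - t \<cdot>\<^sub>v (C *\<^sub>v 0\<^sub>v n)" for t
    by (intro eq_vecI) auto
  then have "(\<lambda>_. 0\<^sub>v n) \<in> solvable_terminals P w n C Cbar N"
    unfolding solvable_terminals_def
    by (intro CollectI conjI exI[of _ "\<lambda>_ _. 0\<^sub>v n"] allI impI AE_I2 refl) (simp_all only: zero)
  from ctrl[OF this] zero N show "\<exists>N>0. \<exists>u\<in>l2F P w N m. AE \<omega> in P. trajectory u x (Suc N) \<omega> = 0\<^sub>v n"
    by blast
qed

section \<open>Steering by an invertible Gramian\<close>

text \<open>The input \<open>D\<^sup>T p\<close>, with \<open>p\<close> the adjoint trajectory, solves the backward equation with zero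
  terminal value explicitly: the solution is the remaining Gramian applied to \<open>p\<close>.\<close>
lemma gram_adj_backward:
  fixes a :: rvec and k :: nat and \<omega> :: 'a
  assumes a: "a \<in> carrier_vec n"
  defines "p \<equiv> adj a k \<omega>"
  shows "gram (Suc j) *\<^sub>v p = C *\<^sub>v (gram j *\<^sub>v adj a (Suc k) \<omega>) + Cbar *\<^sub>v (gram j *\<^sub>v (Cbar\<^sup>T *\<^sub>v p)) +
    D *\<^sub>v (D\<^sup>T *\<^sub>v p) - w k \<omega> \<cdot>\<^sub>v (C *\<^sub>v (gram j *\<^sub>v (Cbar\<^sup>T *\<^sub>v p)))"
proof -
  have p: "p \<in> carrier_vec n" using a by (simp add: p_def)
  let ?c = "C *\<^sub>v (gram j *\<^sub>v (C\<^sup>T *\<^sub>v p))" and ?z = "C *\<^sub>v (gram j *\<^sub>v (Cbar\<^sup>T *\<^sub>v p))"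
  have eq: "C *\<^sub>v (gram j *\<^sub>v adj a (Suc k) \<omega>) = ?c + w k \<omega> \<cdot>\<^sub>v ?z"
    using p by (simp add: p_def[symmetric] mult_add_distrib_mat_vec[OF gram_carrier]
        mult_mat_vec[OF gram_carrier] mult_vec_add mult_vec_smult)
  \<comment> \<open>The noise part of \<open>adj a (Suc k) \<omega>\<close> contributes exactly the
    term that the backward equation subtracts.\<close>
  have cancel: "c + b + d = (c + t \<cdot>\<^sub>v z) + b + d - t \<cdot>\<^sub>v z"
    if "c \<in> carrier_vec n" "b \<in> carrier_vec n" "d \<in> carrier_vec n" "z \<in> carrier_vec n"
    for b c d z :: rvec and t
    using that by (intro eq_vecI) auto
  show ?thesis
    unfolding gram_Suc_mult_vec[OF p] eq by (rule cancel) (use p in auto)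
qed

lemma gram_invertible_imp_controllable:
  assumes N: "N > 0" and inv: "invertible_mat (gram (Suc N))"
  shows "exactly_controllable P w n m A Abar B Bbar C Cbar"
  unfolding exactly_controllable_def
proof (intro ballI impI exI conjI)
  fix x :: rvec and \<xi>
  assume x: "x \<in> carrier_vec n" and \<xi>: "\<xi> \<in> solvable_terminals P w n C Cbar N"
  obtain xt zt where xt: "\<And>k. k \<le> N \<Longrightarrow> xt k \<in> L2F k n" and zt: "\<And>k. k \<le> N \<Longrightarrow> zt k \<in> L2F k n"
    and xtN: "xt (Suc N) = \<xi>" and \<xi>L2: "\<xi> \<in> L2 P n"
    and bw: "\<And>k. k \<le> N \<Longrightarrow>
      AE \<omega> in P. xt k \<omega> = C *\<^sub>v xt (Suc k) \<omega> + Cbar *\<^sub>v zt k \<omega> - w k \<omega> \<cdot>\<^sub>v (C *\<^sub>v zt k \<omega>)"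
    using \<xi> unfolding solvable_terminals_def L2F_def by blast
  \<comment> \<open>Adaptedness of \<open>xt\<close> is given only up to time \<open>N\<close>; at
    \<open>Suc N\<close> the shape comes from the target.\<close>
  have xt_carrier: "xt k \<omega> \<in> carrier_vec n" if "k \<le> Suc N" "\<omega> \<in> space P" for k \<omega>
    using that xt[of k] L2F_carrier \<xi>L2 xtN
    by (cases "k = Suc N") (auto simp: L2_def vec_measurable_def)
  \<comment> \<open>An arbitrary reference outcome: \<open>xt 0\<close> is measurable for the
    trivial \<sigma>-algebra, so its value there is its value everywhere.\<close>
  obtain \<omega>0 where \<omega>0: "\<omega>0 \<in> space P" using not_empty by blast
  have xt0: "xt 0 \<omega> = xt 0 \<omega>0" if "\<omega> \<in> space P" for \<omega>
  proof (rule eq_vecI)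
    fix i assume "i < dim_vec (xt 0 \<omega>0)"
    then have "(\<lambda>\<omega>. xt 0 \<omega> $ i) \<in> borel_measurable (past P w 0)"
      using xt[of 0] L2F_dim[OF xt[of 0] \<omega>0] by (auto simp: L2F_iff past_L2_def)
    then show "xt 0 \<omega> $ i = xt 0 \<omega>0 $ i"
      using that \<omega>0 by (rule measurable_past_0_const)
  qed (use L2F_dim[OF xt[of 0]] \<omega>0 that in simp)
  obtain G where G: "G \<in> carrier_mat n n" "gram (Suc N) * G = 1\<^sub>m n"
    using invertible_mat_inverseE[OF gram_carrier inv] by metis
  \<comment> \<open>Chosen so that \<open>gram (Suc N) *\<^sub>v a\<close> makes up the difference
    between \<open>x\<close> and the start of the given backward solution.\<close>
  define a where "a = G *\<^sub>v (x - xt 0 \<omega>0)"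
  have a: "a \<in> carrier_vec n" using G x xt_carrier[of 0] \<omega>0 by (simp add: a_def)
  have x0: "x - xt 0 \<omega>0 \<in> carrier_vec n" using x xt_carrier[of 0] \<omega>0 by simp
  have "gram (Suc N) *\<^sub>v a = (gram (Suc N) * G) *\<^sub>v (x - xt 0 \<omega>0)"
    unfolding a_def by (rule assoc_mult_mat_vec[OF gram_carrier G(1) x0, symmetric])
  then have Ga: "gram (Suc N) *\<^sub>v a = x - xt 0 \<omega>0"
    unfolding G(2) using x0 by (simp del: gram.simps)
  \<comment> \<open>At time 0 this is \<open>x\<close> by the choice of \<open>a\<close>; at
    \<open>Suc N\<close> the remaining Gramian is \<open>gram 0\<close>, which is zero, so the end
    value is \<xi>.\<close>
  define X where "X k \<omega> = xt k \<omega> + gram (Suc N - k) *\<^sub>v adj a k \<omega>" for k \<omega>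
  define Z where "Z k \<omega> = zt k \<omega> + gram (N - k) *\<^sub>v (Cbar\<^sup>T *\<^sub>v adj a k \<omega>)" for k \<omega>
  define V where "V k \<omega> = D\<^sup>T *\<^sub>v adj a k \<omega>" for k \<omega>
  define u where "u k \<omega> = M *\<^sub>v ((Z k \<omega> - Abar *\<^sub>v X k \<omega>) @\<^sub>v V k \<omega>)" for k \<omega>
  have XZV: "X k \<in> L2F k n" "Z k \<in> L2F k n" "V k \<in> L2F k (m - n)" if "k \<le> N" for k
    unfolding X_def[abs_def] Z_def[abs_def] V_def[abs_def] using that a
    by (auto intro!: L2F_add xt zt L2F_mult[of _ _ n] adj_L2F)
  show "\<exists>u\<in>l2F P w N m. AE \<omega> in P. trajectory u x (Suc N) \<omega> = \<xi> \<omega>"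
  proof (rule bexI)
    have "u k \<in> L2F k m" if "k \<le> N" for k
    proof -
      have "(\<lambda>\<omega>. (Z k \<omega> - Abar *\<^sub>v X k \<omega>) @\<^sub>v V k \<omega>) \<in> L2F k (n + (m - n))"
        using XZV[OF that] by (intro L2F_append L2F_diff L2F_mult[OF _ Abar_carrier])
      then show ?thesis
        unfolding u_def[abs_def] m_eq[symmetric] by (rule L2F_mult[OF _ M_carrier])
    qed
    then show "u \<in> l2F P w N m" by (simp add: l2F_iff)
    \<comment> \<open>Finitely many exceptional null sets are united, and the rest is an induction
      on time for a single outcome.\<close>
    have "AE \<omega> in P. \<forall>k\<in>{..N}. xt k \<omega> = C *\<^sub>v xt (Suc k) \<omega> + Cbar *\<^sub>v zt k \<omega> - w k \<omega> \<cdot>\<^sub>v (C *\<^sub>v zt k \<omega>)"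
      using bw by (intro AE_finite_allI) auto
    then show "AE \<omega> in P. trajectory u x (Suc N) \<omega> = \<xi> \<omega>"
      using AE_space
    proof eventually_elim
      case (elim \<omega>)
      have zc: "zt k \<omega> \<in> carrier_vec n" if "k \<le> N" for k
        using L2F_carrier[OF zt[OF that]] elim by simp
      have Xc: "X k \<omega> \<in> carrier_vec n" if "k \<le> Suc N" for k
        using xt_carrier[OF that] elim a by (simp add: X_def)
      have "trajectory u x k \<omega> = X k \<omega>" if "k \<le> Suc N" for k
        using that
      proof (induction k)
        case 0
        show ?case using xt0[of \<omega>] elim Ga x xt_carrier[of 0 \<omega>0] \<omega>0
          by (auto simp: X_def simp del: gram.simps)
      next
        case (Suc k)
        then have k: "k \<le> N" by simp
        have backward_gram: "gram (Suc (N - k)) *\<^sub>v adj a k \<omega> = C *\<^sub>v (gram (N - k) *\<^sub>v adj a (Suc k) \<omega>) +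
            Cbar *\<^sub>v (gram (N - k) *\<^sub>v (Cbar\<^sup>T *\<^sub>v adj a k \<omega>)) + D *\<^sub>v V k \<omega> -
            w k \<omega> \<cdot>\<^sub>v (C *\<^sub>v (gram (N - k) *\<^sub>v (Cbar\<^sup>T *\<^sub>v adj a k \<omega>)))"
          unfolding V_def by (rule gram_adj_backward[OF a])
        have backward: "xt k \<omega> = C *\<^sub>v xt (Suc k) \<omega> + Cbar *\<^sub>v zt k \<omega> - w k \<omega> \<cdot>\<^sub>v (C *\<^sub>v zt k \<omega>)"
          using elim k by simp
        \<comment> \<open>Adds the given backward solution to the explicit one; only the latter
          carries the input term \<open>d\<close>.\<close>
        have superpose: "(c + b - t \<cdot>\<^sub>v z) + (c' + b' + d - t \<cdot>\<^sub>v z') =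
            (c + c') + (b + b') + d - t \<cdot>\<^sub>v (z + z')"
          if "c \<in> carrier_vec n" "c' \<in> carrier_vec n" "b \<in> carrier_vec n" "b' \<in> carrier_vec n"
            "d \<in> carrier_vec n" "z \<in> carrier_vec n" "z' \<in> carrier_vec n"
          for b b' c c' d z z' :: rvec and t
          using that by (intro eq_vecI) (auto simp: distrib_left)
        have c: "xt (Suc k) \<omega> \<in> carrier_vec n" "zt k \<omega> \<in> carrier_vec n" "V k \<omega> \<in> carrier_vec (m - n)"
          "gram (N - k) *\<^sub>v adj a (Suc k) \<omega> \<in> carrier_vec n"
          "gram (N - k) *\<^sub>v (Cbar\<^sup>T *\<^sub>v adj a k \<omega>) \<in> carrier_vec n"
          using xt_carrier[of "Suc k" \<omega>] k elim zc[OF k] a by (simp_all add: V_def del: adj.simps)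
        have "X k \<omega> = C *\<^sub>v X (Suc k) \<omega> + Cbar *\<^sub>v Z k \<omega> + D *\<^sub>v V k \<omega> - w k \<omega> \<cdot>\<^sub>v (C *\<^sub>v Z k \<omega>)"
          unfolding X_def[of k] X_def[of "Suc k"] Z_def Suc_diff_le[OF k] diff_Suc_Suc backward
            backward_gram mult_vec_add(1)[OF c(1,4)] mult_vec_add(1,2)[OF c(2,5)]
          by (rule superpose) (use c in \<open>simp_all del: adj.simps\<close>)
        moreover have "X k \<omega> \<in> carrier_vec n" "X (Suc k) \<omega> \<in> carrier_vec n" "Z k \<omega> \<in> carrier_vec n"
          "V k \<omega> \<in> carrier_vec (m - n)"
          using k XZV[OF k] Xc[of "Suc k"] L2F_carrier elim by auto
        ultimately show ?case
          using forward_step[of "X k \<omega>" "X (Suc k) \<omega>" "Z k \<omega>" "V k \<omega>" "w k \<omega>"] Suc k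
          by (simp add: u_def)
      qed
      from this[of "Suc N"] show ?case
        using xt_carrier[of "Suc N" \<omega>] elim a by (simp add: X_def xtN zero_mat_mult_vec)
    qed
  qed
qed (rule N)

end


theorem theorem3:
  fixes P :: "'a measure" and w :: "nat \<Rightarrow> 'a \<Rightarrow> real"
    and n m :: nat
    and A Abar B Bbar M L F C Cbar D :: "real Matrix.mat"
  assumes "prob_space P" and "complete_measure P"
    and "iid_noise P w"
    and "A \<in> carrier_mat n n" and "Abar \<in> carrier_mat n n"
    and "B \<in> carrier_mat n m" and "Bbar \<in> carrier_mat n m"
    and "vec_space.rank n Bbar = n"
    and "M \<in> carrier_mat m m" and "invertible_mat M"
    and "Bbar * M = append_cols (1\<^sub>m n) (0\<^sub>m n (m - n))"
    and "L \<in> carrier_mat n n" and "F \<in> carrier_mat n (m - n)"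
    and "B * M = append_cols L F"
    and "invertible_mat (A - L * Abar)"
    and "C = the (mat_inverse (A - L * Abar))"
    and "Cbar = - (C * L)"
    and "D = - (C * F)"
  shows "(exactly_controllable P w n m A Abar B Bbar C Cbar \<longleftrightarrow>
            exactly_null_controllable P w n m A Abar B Bbar) \<and>
         (exactly_null_controllable P w n m A Abar B Bbar \<longleftrightarrow>
            (\<exists>N>0. invertible_mat (gramian P w n C Cbar D N))) \<and>
         ((\<exists>N>0. invertible_mat (gramian P w n C Cbar D N)) \<longleftrightarrow>
            vec_space.cols_rank n (R_cols n C Cbar D) = n)"
proof -
  interpret control_system P w n m A Abar B Bbar M L F C Cbar D
    using assms by (intro control_system.intro noise_space.intro noise_space_axioms.intro
        control_system_axioms.intro)
  \<comment> \<open>The implications close a cycle: exact controllability, null controllability,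
    full rank, invertible Gramian, exact controllability.\<close>
  show ?thesis
    using exactly_controllable_imp_null_controllable null_controllable_imp_full_rank
      gram_invertible_imp_controllable
    unfolding gramian_eq_gram cols_rank_iff_gram by blast
qed

end
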